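(* Let $x\in\mathbb{R}^N\setminus\{0\}$ with saturation support $I=\{i:|x_i|=\|x\|_\infty\}$, and let $\beta>1$. Let $\Phi\in\mathbb{R}^{Q\times N}$ be drawn from the standard Gaussian ensemble (i.i.d. $\mathcal N(0,1)$ entries) with $$Q\ge N-|I|+2\beta|I|\log(|I|/2).$$ Then, for the regularizer $J=\|\cdot\|_\infty$, $\mathbf{IC}(x)<1$ with probability at least $1-2(|I|/2)^{-f(\beta,|I|)}$, where $$f(\beta,|I|)=\left(\sqrt{\frac{\beta}{2|I|}+\beta-1}-\sqrt{\frac{\beta}{2|I|}}\right)^2.$$
   Context: For $J=\|\cdot\|_\infty$ and $x\neq0$, let $s\in\mathbb{R}^N$ with $s_i=\operatorname{sign}(x_i)$ for $i\in I$ and $s_i=0$ otherwise, and let $v_{(I)}$ denote the restriction of $v$ to the indices in $I$. The model subspace is $T_x=\{\alpha\in\mathbb{R}^N:\alpha_{(I)}=\rho s_{(I)}\text{ for some }\rho\in\mathbb{R}\}$, $S_x=T_x^\perp=\{\eta:\eta_{(I^c)}=0,\ \langle\eta_{(I)},s_{(I)}\rangle=0\}$, and the model vector is $e_x=s/|I|$ (one chooses $f_x=e_x$, so $P_{S_x}f_x=0$). For $\eta\in S_x$ the subdifferential gauge is $J_{f_x}^{x,\circ}(\eta)=\max_{i\in I}(-|I|s_i\eta_i)_+$, where $(\cdot)_+$ is the positive part. The irrepresentability criterion is $$\mathbf{IC}(x)=J_{f_x}^{x,\circ}\big(\Phi_{S_x}^*\Phi_{T_x}^{+,*}e_x\big),$$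 defined when $\operatorname{Ker}(\Phi)\cap T_x=\{0\}$, where $\Phi_V=\Phi P_V$ with $P_V$ the orthogonal projector onto $V$, $A^+$ is the Moore–Penrose pseudo-inverse and $A^{+,*}=(A^+)^*$. *)

theory Defs
  imports "HOL-Probability.Probability"
begin

definition orth_proj :: "'a::euclidean_space set \<Rightarrow> 'a \<Rightarrow> 'a" where
  "orth_proj V v = (THE u. u \<in> V \<and> (\<forall>w\<in>V. orthogonal (v - u) w))"

lemma orth_proj_ex1:
  fixes V :: "'a::euclidean_space set"
  assumes "subspace V"
  shows "\<exists>!u. u \<in> V \<and> (\<forall>w\<in>V. orthogonal (v - u) w)"
proof (rule ex_ex1I)
  obtain y z where yz: "y \<in> span V" "\<And>w. w \<in> span V \<Longrightarrow> orthogonal z w" "v = y + z"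
    using orthogonal_subspace_decomp_exists[of V v] by metis
  have "span V = V" using assms by (metis span_eq_iff)
  then have "y \<in> V" "\<And>w. w \<in> V \<Longrightarrow> orthogonal z w"
    using yz(1,2) by metis+
  then show "\<exists>u. u \<in> V \<and> (\<forall>w\<in>V. orthogonal (v - u) w)"
    using yz(3) by (intro exI[of _ y]) simp
next
  fix u u'
  assume u: "u \<in> V \<and> (\<forall>w\<in>V. orthogonal (v - u) w)"
    and u': "u' \<in> V \<and> (\<forall>w\<in>V. orthogonal (v - u') w)"
  have d: "u - u' \<in> V" using u u' assms by (simp add: subspace_diff)
  have "(v - u') \<bullet> (u - u') - (v - u) \<bullet> (u - u') = 0"
    using u u' d by (simp add: orthogonal_def)
  then have "(u - u') \<bullet> (u - u') = 0" by (simp add: inner_diff_left)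
  then show "u = u'" by simp
qed

lemma orth_proj_eqI:
  assumes "subspace V" "u \<in> V" "\<And>w. w \<in> V \<Longrightarrow> orthogonal (v - u) w"
  shows "orth_proj V v = u"
  unfolding orth_proj_def using the1_equality[OF orth_proj_ex1[OF assms(1)]] assms(2,3) by blast

lemma
  assumes "subspace V"
  shows orth_proj_in: "orth_proj V v \<in> V"
    and orth_proj_orthogonal: "w \<in> V \<Longrightarrow> orthogonal (v - orth_proj V v) w"
  using theI'[OF orth_proj_ex1[OF assms, of v]] unfolding orth_proj_def by auto

lemma linear_orth_proj:
  assumes "subspace V"
  shows "linear (orth_proj V)"
proof (rule linearI)
  fix x y
  show "orth_proj V (x + y) = orth_proj V x + orth_proj V y"
    using orth_proj_orthogonal[OF assms, of _ x] orth_proj_orthogonal[OF assms, of _ y]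
    by (intro orth_proj_eqI assms subspace_add orth_proj_in)
       (auto simp: orthogonal_def algebra_simps inner_simps)
next
  fix r x
  show "orth_proj V (r *\<^sub>R x) = r *\<^sub>R orth_proj V x"
    using orth_proj_orthogonal[OF assms, of _ x]
    by (intro orth_proj_eqI assms subspace_scale orth_proj_in)
       (auto simp: orthogonal_def algebra_simps inner_simps)
qed

lemma orth_proj_sym:
  assumes "subspace V"
  shows "orth_proj V x \<bullet> y = x \<bullet> orth_proj V y"
  using orth_proj_orthogonal[OF assms, of "orth_proj V y" x] orth_proj_in[OF assms]
    orth_proj_orthogonal[OF assms, of "orth_proj V x" y]
  by (simp add: orthogonal_def inner_simps inner_commute)

definition proj_matrix :: "(real^'n) set \<Rightarrow> real^'n^'n" where
  "proj_matrix V = matrix (orth_proj V)"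

definition moore_penrose :: "real^'n^'m \<Rightarrow> real^'m^'n \<Rightarrow> bool" where
  "moore_penrose A B \<longleftrightarrow>
     A ** B ** A = A \<and> B ** A ** B = B \<and>
     transpose (A ** B) = A ** B \<and> transpose (B ** A) = B ** A"

definition pinv :: "real^'n^'m \<Rightarrow> real^'m^'n" where
  "pinv A = (THE B. moore_penrose A B)"

lemma moore_penrose_unique:
  assumes B: "moore_penrose A B" and C: "moore_penrose A C"
  shows "B = C"
proof -
  have "A ** B = transpose B ** transpose A"
    using B by (metis moore_penrose_def matrix_transpose_mul)
  also have "\<dots> = transpose B ** transpose (A ** C ** A)"
    using C by (simp add: moore_penrose_def)
  also have "\<dots> = transpose (A ** B) ** transpose (A ** C)"
    by (simp add: matrix_transpose_mul matrix_mul_assoc)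
  also have "\<dots> = A ** B ** (A ** C)" using B C by (simp add: moore_penrose_def)
  also have "\<dots> = A ** C" using B by (simp add: moore_penrose_def matrix_mul_assoc)
  finally have AB: "A ** B = A ** C" .
  have "B ** A = transpose A ** transpose B"
    using B by (metis moore_penrose_def matrix_transpose_mul)
  also have "\<dots> = transpose (A ** C ** A) ** transpose B"
    using C by (simp add: moore_penrose_def)
  also have "\<dots> = transpose (C ** A) ** transpose (B ** A)"
    by (simp add: matrix_transpose_mul matrix_mul_assoc)
  also have "\<dots> = C ** A ** (B ** A)" using B C by (simp add: moore_penrose_def)
  also have "\<dots> = C ** (A ** B ** A)" by (simp add: matrix_mul_assoc)
  also have "\<dots> = C ** A" using B by (simp add: moore_penrose_def)
  finally have BA: "B ** A = C ** A" .
  have "B = B ** A ** B" using B by (simp add: moore_penrose_def)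
  also have "\<dots> = C ** (A ** B)" by (simp add: BA matrix_mul_assoc)
  also have "\<dots> = C" using C by (simp add: AB moore_penrose_def matrix_mul_assoc)
  finally show ?thesis .
qed

lemma moore_penrose_exists:
  fixes A :: "real^'n^'m"
  shows "\<exists>B. moore_penrose A B"
proof -
  let ?f = "(*v) A"
  define V where "V = range ((*v) (transpose A))"
  define R where "R = range ?f"
  have subV: "subspace V" and subR: "subspace R"
    unfolding V_def R_def by (intro linear_subspace_image matrix_vector_mul_linear subspace_UNIV)+
  have ker: "A *v v = 0" if "\<And>w. w \<in> V \<Longrightarrow> orthogonal v w" for v
  proof -
    have "orthogonal v (transpose A *v (A *v v))" using that unfolding V_def by blast
    then have "(A *v v) \<bullet> (A *v v) = 0"
      by (simp add: orthogonal_def dot_lmul_matrix[symmetric] vector_transpose_matrix inner_commute)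
    then show ?thesis by simp
  qed
  have fP: "A *v orth_proj V v = A *v v" for v
    using ker[OF orth_proj_orthogonal[OF subV, of _ v]] by (simp add: matrix_vector_mult_diff_distrib)
  have "inj_on ?f V"
  proof (rule inj_onI)
    fix a b assume ab: "a \<in> V" "b \<in> V" "A *v a = A *v b"
    then obtain y where y: "a - b = transpose A *v y"
      using subspace_diff[OF subV] unfolding V_def by blast
    have "(a - b) \<bullet> (a - b) = y \<bullet> (A *v (a - b))"
      by (subst (1) y) (simp add: dot_lmul_matrix[symmetric] vector_transpose_matrix)
    also have "\<dots> = 0" using ab by (simp add: matrix_vector_mult_diff_distrib)
    finally show "a = b" by simp
  qed
  then obtain g where g: "g ` UNIV \<subseteq> V" "linear g" "\<And>v. v \<in> V \<Longrightarrow> g (A *v v) = v"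
    using linear_exists_left_inverse_on[OF matrix_vector_mul_linear subV] by blast
  define B where "B = matrix (g \<circ> orth_proj R)"
  have B: "B *v y = g (orth_proj R y)" for y
    unfolding B_def by (simp add: matrix_works linear_compose linear_orth_proj subR g(2))
  have idR: "orth_proj R y = y" if "y \<in> R" for y
    using that subR by (intro orth_proj_eqI) (auto simp: orthogonal_def)
  have idV: "orth_proj V y = y" if "y \<in> V" for y
    using that subV by (intro orth_proj_eqI) (auto simp: orthogonal_def)
  have gf: "g (A *v v) = orth_proj V v" for v
    using g(3)[OF orth_proj_in[OF subV, of v]] by (simp add: fP)
  have AB: "A *v (B *v y) = orth_proj R y" for y
  proof -
    obtain x where "orth_proj R y = A *v x"
      using orth_proj_in[OF subR, of y] unfolding R_def by blast
    then show ?thesis by (simp add: B gf fP)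
  qed
  have BA: "B *v (A *v v) = orth_proj V v" for v
    using gf idR by (simp add: B R_def)
  have sym: "transpose (C :: real^'k^'k) = C" if "\<And>x y. (C *v x) \<bullet> y = x \<bullet> (C *v y)" for C
  proof (rule matrix_eq[THEN iffD2], rule allI, rule vector_eq_rdot[THEN iffD1], rule allI)
    fix x z
    show "(transpose C *v x) \<bullet> z = (C *v x) \<bullet> z"
      by (simp add: that transpose_matrix_vector dot_lmul_matrix)
  qed
  have "moore_penrose A B"
    unfolding moore_penrose_def
  proof (intro conjI)
    show "A ** B ** A = A"
      by (simp add: matrix_eq matrix_vector_mul_assoc[symmetric] BA fP)
    have "B *v y \<in> V" for y using g(1) by (auto simp: B)
    then show "B ** A ** B = B"
      by (simp add: matrix_eq matrix_vector_mul_assoc[symmetric] BA idV)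
    show "transpose (A ** B) = A ** B"
      by (rule sym) (simp add: matrix_vector_mul_assoc[symmetric] AB orth_proj_sym subR)
    show "transpose (B ** A) = B ** A"
      by (rule sym) (simp add: matrix_vector_mul_assoc[symmetric] BA orth_proj_sym subV)
  qed
  then show ?thesis ..
qed

lemma moore_penrose_pinv: "moore_penrose A (pinv A)"
  unfolding pinv_def by (rule theI') (blast intro: moore_penrose_exists moore_penrose_unique)

definition sat_supp :: "real^'n \<Rightarrow> 'n set" where
  "sat_supp x = {i. \<bar>x $ i\<bar> = infnorm x}"

definition sat_sign :: "real^'n \<Rightarrow> real^'n" where
  "sat_sign x = (\<chi> i. if i \<in> sat_supp x then sgn (x $ i) else 0)"

definition model_space :: "real^'n \<Rightarrow> (real^'n) set" where
  "model_space x = {\<alpha>. \<exists>\<rho>. \<forall>i\<in>sat_supp x. \<alpha> $ i = \<rho> * sat_sign x $ i}"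

definition model_vector :: "real^'n \<Rightarrow> real^'n" where
  "model_vector x = (1 / real (card (sat_supp x))) *\<^sub>R sat_sign x"

text \<open>The gauge at \<open>x\<close> for the choice \<open>f\<^sub>x = e\<^sub>x\<close>; the formula
  is meaningful for \<open>\<eta>\<close> in the orthogonal complement of \<^term>\<open>model_space x\<close> only.\<close>

definition subdiff_gauge :: "real^'n \<Rightarrow> real^'n \<Rightarrow> real" where
  "subdiff_gauge x \<eta> =
     Max ((\<lambda>i. max 0 (- real (card (sat_supp x)) * sat_sign x $ i * \<eta> $ i)) ` sat_supp x)"

definition restr :: "real^'n^'q \<Rightarrow> (real^'n) set \<Rightarrow> real^'n^'q" where
  "restr \<Phi> V = \<Phi> ** proj_matrix V"

text \<open>The criterion is only defined under \<open>IC_defined\<close>; elsewhere the value of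
  \<open>IC\<close> has no meaning.\<close>

definition IC_defined :: "real^'n^'q \<Rightarrow> real^'n \<Rightarrow> bool" where
  "IC_defined \<Phi> x \<longleftrightarrow> {v. \<Phi> *v v = 0} \<inter> model_space x = {0}"

definition IC :: "real^'n^'q \<Rightarrow> real^'n \<Rightarrow> real" where
  "IC \<Phi> x = subdiff_gauge x
     (transpose (restr \<Phi> ((model_space x)\<^sup>\<bottom>)) *v
       (transpose (pinv (restr \<Phi> (model_space x))) *v model_vector x))"

lemma subspace_model_space: "subspace (model_space x)"
proof (rule subspaceI)
  show "0 \<in> model_space x" by (auto simp: model_space_def intro: exI[of _ 0])
next
  fix a b assume "a \<in> model_space x" "b \<in> model_space x"
  then obtain \<rho> \<sigma> where "\<forall>i\<in>sat_supp x. a $ i = \<rho> * sat_sign x $ i"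
      "\<forall>i\<in>sat_supp x. b $ i = \<sigma> * sat_sign x $ i"
    by (auto simp: model_space_def)
  then show "a + b \<in> model_space x"
    by (auto simp: model_space_def algebra_simps intro!: exI[of _ "\<rho> + \<sigma>"])
next
  fix c a assume "a \<in> model_space x"
  then obtain \<rho> where "\<forall>i\<in>sat_supp x. a $ i = \<rho> * sat_sign x $ i"
    by (auto simp: model_space_def)
  then show "c *\<^sub>R a \<in> model_space x"
    by (auto simp: model_space_def intro!: exI[of _ "c * \<rho>"])
qed

definition std_gaussian_ensemble :: "'w measure \<Rightarrow> ('w \<Rightarrow> real^'n^'q) \<Rightarrow> bool" where
  "std_gaussian_ensemble M \<Phi> \<longleftrightarrow>
     prob_space M \<and>
     prob_space.indep_vars M (\<lambda>_. borel) (\<lambda>(q, n) \<omega>. \<Phi> \<omega> $ q $ n) (UNIV :: ('q \<times> 'n) set) \<and>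
     (\<forall>q n. distributed M lborel (\<lambda>\<omega>. \<Phi> \<omega> $ q $ n) std_normal_density)"

definition decay_exponent :: "real \<Rightarrow> nat \<Rightarrow> real" where
  "decay_exponent \<beta> n = (sqrt (\<beta> / (2 * n) + \<beta> - 1) - sqrt (\<beta> / (2 * n)))\<^sup>2"

end

theory Submission
  imports Defs
begin

text \<open>
  Write \<open>k\<close> for the size of the saturation support \<open>I\<close>, \<open>s\<close> for the sign vector and
  \<open>c\<^sub>j\<close> for the columns of \<open>\<Phi>\<close>.  Let \<open>\<Pi>\<close> be the orthogonal projector onto the complement
  of the span of the columns \<open>c\<^sub>j\<close> with \<open>j \<notin> I\<close>.

  The algebraic half: the vector \<open>u\<close> that the pseudo-inverse produces from the model vector
  lies in the image of the model space, is orthogonal to every \<open>c\<^sub>j\<close> with \<open>j \<notin> I\<close> and satisfies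
  \<open>u \<bullet> \<Phi> s = 1\<close>; hence it is a positive multiple of \<open>\<Pi> \<Phi> s\<close>.  Projecting a coordinate vector
  \<open>i \<in> I\<close> onto the complement of the model space subtracts \<open>(s\<^sub>i / k) s\<close> from it, so the \<open>i\<close>-th
  term in the gauge is \<open>1 - k s\<^sub>i (u \<bullet> c\<^sub>i)\<close>.  Therefore the criterion is below one exactly if
  \<open>s\<^sub>i c\<^sub>i \<bullet> \<Pi> (\<Sum>j\<in>I. s\<^sub>j c\<^sub>j) > 0\<close> for all \<open>i \<in> I\<close>
  (\<open>IC_less_one_iff\<close>, \<open>IC_less_one_if_projected_correlations_pos\<close>).

  The probabilistic half: fix the columns outside \<open>I\<close>.  They are almost surely linearly independent,
  and \<open>\<Pi>\<close> is then a fixed projector of rank at least \<open>m = Q - N + k\<close>.  The vectors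
  \<open>g\<^sub>i = s\<^sub>i c\<^sub>i\<close> are standard Gaussian and independent of each other and of \<open>\<Pi>\<close>.  For
  one \<open>i\<close>, Markov's inequality for \<open>exp (- \<lambda> (g\<^sub>i \<bullet> \<Pi> (\<Sum>j\<in>I. g\<^sub>j)))\<close> with
  \<open>\<lambda> = 1 / (k - 1)\<close>, integrating first over the \<open>g\<^sub>j\<close> with \<open>j \<noteq> i\<close> and then over \<open>g\<^sub>i\<close>,
  bounds the probability of a nonpositive correlation by \<open>(1 - 1/k) powr (m/2)\<close>
  (\<open>gauss_projected_correlation_tail\<close>).  A union bound over \<open>I\<close> and \<open>1 - 1/k \<le> exp (- 1/k)\<close>
  give the failure probability \<open>k exp (- m / (2 k)) \<le> 2 (k/2) powr (1 - \<beta>)\<close>, and the claimed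
  exponent is at most \<open>\<beta> - 1\<close> (\<open>decay_exponent_le\<close>).  For \<open>k \<le> 2\<close> the claimed lower bound is
  negative.

  Two further points need an argument.  The success event has to be measurable, which follows
  because it is described by compact projections of closed sets
  (\<open>sets_borel_IC_less_one\<close>).  The Gaussian integral of \<open>exp (- c (norm (\<Pi> a))\<^sup>2)\<close> requires
  rotation invariance, which is derived from the translation invariance of Lebesgue measure
  (\<open>nn_integral_lborel_isometry\<close>).
\<close>

section \<open>The standard Gaussian measure on a Euclidean space\<close>

definition gauss :: "'a::euclidean_space measure" where
  "gauss = density lborel (\<lambda>x. \<Prod>b\<in>Basis. ennreal (std_normal_density (x \<bullet> b)))"

lemma sets_gauss [simp, measurable_cong]: "sets gauss = sets borel"
  by (simp add: gauss_def)

lemma space_gauss [simp]: "space gauss = UNIV"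
  by (simp add: gauss_def)

lemma nn_integral_gauss_prod:
  fixes g :: "'a::euclidean_space \<Rightarrow> real \<Rightarrow> ennreal"
  assumes [measurable]: "\<And>b. b \<in> Basis \<Longrightarrow> g b \<in> borel_measurable borel"
  shows "(\<integral>\<^sup>+x. (\<Prod>b\<in>Basis. g b (x \<bullet> b)) \<partial>gauss)
       = (\<Prod>b\<in>Basis. \<integral>\<^sup>+t. ennreal (std_normal_density t) * g b t \<partial>lborel)"
proof -
  have "(\<integral>\<^sup>+x. (\<Prod>b\<in>Basis. g b (x \<bullet> b)) \<partial>gauss)
      = (\<integral>\<^sup>+x. (\<Prod>b\<in>Basis. ennreal (std_normal_density (x \<bullet> b)) * g b (x \<bullet> b)) \<partial>lborel)"
    unfolding gauss_def by (subst nn_integral_density) (auto simp: prod.distrib)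
  also have "\<dots> = (\<Prod>b\<in>Basis. \<integral>\<^sup>+t. ennreal (std_normal_density t) * g b t \<partial>lborel)"
    by (rule nn_integral_lborel_prod[where f = "\<lambda>b t. ennreal (std_normal_density t) * g b t"]) auto
  finally show ?thesis .
qed

lemma nn_integral_normal_density:
  assumes "\<sigma> > 0"
  shows "(\<integral>\<^sup>+t. ennreal (normal_density \<mu> \<sigma> t) \<partial>lborel) = 1"
  by (subst nn_integral_eq_integral) (use assms in auto)

text \<open>Completing the square turns the integrand into a normal density with mean \<open>a\<close>.\<close>

lemma nn_integral_std_normal_exp_linear:
  "(\<integral>\<^sup>+t. ennreal (std_normal_density t) * ennreal (exp (a * t)) \<partial>lborel) = ennreal (exp (a\<^sup>2 / 2))"
proof -
  have "std_normal_density t * exp (a * t) = exp (a\<^sup>2 / 2) * normal_density a 1 t" for t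
    by (simp add: normal_density_def exp_add[symmetric] power2_eq_square field_simps)
  then have "(\<integral>\<^sup>+t. ennreal (std_normal_density t) * ennreal (exp (a * t)) \<partial>lborel)
      = (\<integral>\<^sup>+t. ennreal (exp (a\<^sup>2 / 2)) * ennreal (normal_density a 1 t) \<partial>lborel)"
    by (simp add: ennreal_mult'[symmetric])
  also have "\<dots> = ennreal (exp (a\<^sup>2 / 2))"
    by (subst nn_integral_cmult) (auto simp: nn_integral_normal_density)
  finally show ?thesis .
qed

text \<open>The integrand is a multiple of the centred normal density with variance \<open>1 / (1 + 2 * c)\<close>.\<close>

lemma nn_integral_std_normal_exp_square:
  assumes "c \<ge> 0"
  shows "(\<integral>\<^sup>+t. ennreal (std_normal_density t) * ennreal (exp (- c * t\<^sup>2)) \<partial>lborel)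
       = ennreal (1 / sqrt (1 + 2 * c))"
proof -
  define \<sigma> where "\<sigma> = 1 / sqrt (1 + 2 * c)"
  have \<sigma>: "\<sigma> > 0" "\<sigma>\<^sup>2 = 1 / (1 + 2 * c)"
    using assms by (auto simp: \<sigma>_def power_divide)
  have "std_normal_density t * exp (- c * t\<^sup>2) = \<sigma> * normal_density 0 \<sigma> t" for t
  proof -
    have "sqrt (2 * pi * \<sigma>\<^sup>2) = sqrt (2 * pi) * \<sigma>"
      using \<sigma>(1) by (simp add: real_sqrt_mult)
    moreover have "- t\<^sup>2 / (2 * \<sigma>\<^sup>2) = - t\<^sup>2 / 2 + - c * t\<^sup>2"
      using assms by (simp add: \<sigma>(2) field_simps)
    ultimately show ?thesis
      using \<sigma>(1) by (simp add: normal_density_def mult_exp_exp)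
  qed
  then have "(\<integral>\<^sup>+t. ennreal (std_normal_density t) * ennreal (exp (- c * t\<^sup>2)) \<partial>lborel)
      = (\<integral>\<^sup>+t. ennreal \<sigma> * ennreal (normal_density 0 \<sigma> t) \<partial>lborel)"
    using \<sigma>(1) by (simp add: ennreal_mult'[symmetric])
  also have "\<dots> = ennreal \<sigma>"
    by (subst nn_integral_cmult) (use \<sigma>(1) in \<open>auto simp: nn_integral_normal_density\<close>)
  finally show ?thesis by (simp add: \<sigma>_def)
qed

lemma norm_square_sum_Basis: "(norm (x::'a::euclidean_space))\<^sup>2 = (\<Sum>b\<in>Basis. (x \<bullet> b)\<^sup>2)"
  unfolding power2_norm_eq_inner by (subst euclidean_inner) (simp add: power2_eq_square)

lemma borel_measurable_linear:
  fixes f :: "'a::euclidean_space \<Rightarrow> 'b::euclidean_space"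
  assumes "linear f"
  shows "f \<in> borel_measurable borel"
  using assms by (simp add: borel_measurable_continuous_onI linear_continuous_on linear_conv_bounded_linear)

lemma prob_space_gauss: "prob_space (gauss :: 'a::euclidean_space measure)"
proof (rule prob_spaceI)
  have "(\<integral>\<^sup>+x. (\<Prod>b\<in>Basis. 1) \<partial>(gauss :: 'a measure)) = 1"
    using nn_integral_gauss_prod[where g = "\<lambda>(b::'a) _. 1"]
    by (simp add: nn_integral_normal_density)
  then show "emeasure (gauss :: 'a measure) (space gauss) = 1" by simp
qed

lemma nn_integral_gauss_exp_inner:
  fixes v :: "'a::euclidean_space"
  shows "(\<integral>\<^sup>+x. ennreal (exp (v \<bullet> x)) \<partial>gauss) = ennreal (exp ((norm v)\<^sup>2 / 2))"
proof -
  have "exp (v \<bullet> x) = (\<Prod>b\<in>Basis. exp ((v \<bullet> b) * (x \<bullet> b)))" for x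
    by (subst euclidean_inner) (simp add: exp_sum)
  then have "(\<integral>\<^sup>+x. ennreal (exp (v \<bullet> x)) \<partial>gauss)
      = (\<integral>\<^sup>+x. (\<Prod>b\<in>Basis. ennreal (exp ((v \<bullet> b) * (x \<bullet> b)))) \<partial>gauss)"
    by (simp add: prod_ennreal)
  also have "\<dots> = (\<Prod>b\<in>Basis. ennreal (exp ((v \<bullet> b)\<^sup>2 / 2)))"
    by (subst nn_integral_gauss_prod) (auto simp: nn_integral_std_normal_exp_linear)
  also have "\<dots> = ennreal (exp ((norm v)\<^sup>2 / 2))"
    by (subst prod_ennreal)
       (simp_all add: exp_sum[symmetric] sum_divide_distrib[symmetric] norm_square_sum_Basis)
  finally show ?thesis .
qed

lemma nn_integral_lborel_shift:
  fixes h :: "'a::euclidean_space \<Rightarrow> ennreal"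
  assumes [measurable]: "h \<in> borel_measurable borel"
  shows "(\<integral>\<^sup>+x. h (x + a) \<partial>lborel) = (\<integral>\<^sup>+x. h x \<partial>lborel)"
proof -
  have "(\<integral>\<^sup>+x. h x \<partial>lborel) = (\<integral>\<^sup>+x. h x \<partial>(distr lborel borel ((+) a)))"
    by (simp add: lborel_distr_plus)
  also have "\<dots> = (\<integral>\<^sup>+x. h (x + a) \<partial>lborel)"
    by (subst nn_integral_distr) (auto simp: add.commute)
  finally show ?thesis by simp
qed

text \<open>A linear isometry transports Lebesgue measure to a translation-invariant measure, so the usual
  proof that such a measure is unique up to a factor applies.  The indicator of the unit ball
  \<open>B\<close> is inserted as a weight and moved between the two variables by translations; since \<open>f\<close> maps
  \<open>B\<close> onto itself, the weight has the same integral on both sides and cancels.\<close>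

lemma nn_integral_lborel_isometry:
  fixes f :: "'a::euclidean_space \<Rightarrow> 'a" and g :: "'a \<Rightarrow> ennreal"
  assumes lin: "linear f" and iso: "\<And>x. norm (f x) = norm x"
    and g[measurable]: "g \<in> borel_measurable borel"
  shows "(\<integral>\<^sup>+x. g (f x) \<partial>lborel) = (\<integral>\<^sup>+x. g x \<partial>lborel)"
proof -
  interpret linear f by fact
  have f[measurable]: "f \<in> borel_measurable borel"
    by (rule borel_measurable_linear[OF lin])
  have "inj f"
    unfolding linear_injective_0[OF lin] by (metis iso norm_eq_zero)
  then have "surj f" using lin by (simp add: linear_injective_imp_surjective)
  then obtain f' where f': "\<And>y. f (f' y) = y" by (metis surjD)
  define B where "B = cball (0::'a) 1"
  have B[measurable]: "B \<in> sets borel" by (simp add: B_def)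
  have lB: "emeasure lborel B \<noteq> 0" "emeasure lborel B \<noteq> \<infinity>"
    using emeasure_bounded_finite[of B] content_cball_pos[of 1 "0::'a"]
    by (auto simp: B_def measure_def)
  have "emeasure lborel B * (\<integral>\<^sup>+x. g (f x) \<partial>lborel)
      = (\<integral>\<^sup>+y. \<integral>\<^sup>+x. indicator B y * g (f x) \<partial>lborel \<partial>lborel)"
    by (simp add: nn_integral_cmult nn_integral_multc)
  also have "\<dots> = (\<integral>\<^sup>+y. \<integral>\<^sup>+x. indicator B y * g (f x + y) \<partial>lborel \<partial>lborel)"
  proof (rule nn_integral_cong)
    fix y :: 'a
    show "(\<integral>\<^sup>+x. indicator B y * g (f x) \<partial>lborel) = (\<integral>\<^sup>+x. indicator B y * g (f x + y) \<partial>lborel)"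
      using nn_integral_lborel_shift[of "\<lambda>x. indicator B y * g (f x)" "f' y"] by (simp add: add f')
  qed
  also have "\<dots> = (\<integral>\<^sup>+x. \<integral>\<^sup>+y. indicator B y * g (f x + y) \<partial>lborel \<partial>lborel)"
    by (rule lborel_pair.Fubini') measurable
  also have "\<dots> = (\<integral>\<^sup>+x. \<integral>\<^sup>+y. indicator B (y - f x) * g y \<partial>lborel \<partial>lborel)"
  proof (rule nn_integral_cong)
    fix x :: 'a
    show "(\<integral>\<^sup>+y. indicator B y * g (f x + y) \<partial>lborel) = (\<integral>\<^sup>+y. indicator B (y - f x) * g y \<partial>lborel)"
      using nn_integral_lborel_shift[of "\<lambda>y. indicator B (y - f x) * g y" "f x"]
      by (simp add: add.commute)
  qed
  also have "\<dots> = (\<integral>\<^sup>+y. \<integral>\<^sup>+x. indicator B (y - f x) * g y \<partial>lborel \<partial>lborel)"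
    by (rule lborel_pair.Fubini') measurable
  also have "\<dots> = (\<integral>\<^sup>+y. emeasure lborel B * g y \<partial>lborel)"
  proof (rule nn_integral_cong)
    fix y :: 'a
    have "(\<integral>\<^sup>+x. indicator B (y - f x) * g y \<partial>lborel) = (\<integral>\<^sup>+x. indicator B (- f x) * g y \<partial>lborel)"
      using nn_integral_lborel_shift[of "\<lambda>x. indicator B (y - f x) * g y" "f' y"] by (simp add: add f')
    also have "\<dots> = (\<integral>\<^sup>+x. indicator B x * g y \<partial>lborel)"
      by (intro nn_integral_cong) (auto simp: B_def iso indicator_def)
    finally show "(\<integral>\<^sup>+x. indicator B (y - f x) * g y \<partial>lborel) = emeasure lborel B * g y"
      by (simp add: nn_integral_multc)
  qed
  also have "\<dots> = emeasure lborel B * (\<integral>\<^sup>+y. g y \<partial>lborel)"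
    by (simp add: nn_integral_cmult)
  finally show ?thesis
    using lB by (simp add: ennreal_mult_cancel_left)
qed

text \<open>In this form the density visibly depends on the norm only, which gives rotation invariance.\<close>

lemma gauss_density_eq:
  fixes x :: "'a::euclidean_space"
  shows "(\<Prod>b\<in>Basis. ennreal (std_normal_density (x \<bullet> b)))
       = ennreal ((1 / sqrt (2 * pi)) ^ DIM('a) * exp (- (norm x)\<^sup>2 / 2))"
proof -
  have "(\<Prod>b\<in>Basis. std_normal_density (x \<bullet> b))
      = (1 / sqrt (2 * pi)) ^ DIM('a) * exp (\<Sum>b\<in>Basis. - (x \<bullet> b)\<^sup>2 / 2)"
    by (simp add: std_normal_density_def prod.distrib exp_sum prod_dividef power_divide)
  also have "(\<Sum>b\<in>Basis. - (x \<bullet> b)\<^sup>2 / 2) = - (norm x)\<^sup>2 / 2"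
    by (simp add: sum_divide_distrib[symmetric] sum_negf norm_square_sum_Basis)
  finally show ?thesis by (simp add: prod_ennreal)
qed

lemma nn_integral_gauss_isometry:
  fixes f :: "'a::euclidean_space \<Rightarrow> 'a" and g :: "'a \<Rightarrow> ennreal"
  assumes lin: "linear f" and iso: "\<And>x. norm (f x) = norm x"
    and g[measurable]: "g \<in> borel_measurable borel"
  shows "(\<integral>\<^sup>+x. g (f x) \<partial>gauss) = (\<integral>\<^sup>+x. g x \<partial>gauss)"
proof -
  have f[measurable]: "f \<in> borel_measurable borel"
    by (rule borel_measurable_linear[OF lin])
  define d :: "'a \<Rightarrow> ennreal"
    where "d x = ennreal ((1 / sqrt (2 * pi)) ^ DIM('a) * exp (- (norm x)\<^sup>2 / 2))" for x
  have [measurable]: "d \<in> borel_measurable borel" unfolding d_def by measurable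
  have G: "gauss = density lborel d"
    unfolding gauss_def gauss_density_eq d_def ..
  have "(\<integral>\<^sup>+x. g (f x) \<partial>gauss) = (\<integral>\<^sup>+x. d (f x) * g (f x) \<partial>lborel)"
    unfolding G by (subst nn_integral_density) (auto simp: d_def iso)
  also have "\<dots> = (\<integral>\<^sup>+x. d x * g x \<partial>lborel)"
    by (rule nn_integral_lborel_isometry[OF lin iso, of "\<lambda>x. d x * g x"]) measurable
  also have "\<dots> = (\<integral>\<^sup>+x. g x \<partial>gauss)"
    unfolding G by (subst nn_integral_density) auto
  finally show ?thesis .
qed

section \<open>Gaussian measure and subspaces\<close>

text \<open>Orthonormal bases of \<open>V\<close> and of its complement form an orthonormal basis of the whole space;
  \<open>f\<close> sends the standard basis to it, and \<open>D\<close> is the part that lands in \<open>V\<close>.  After this rotation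
  the projection onto \<open>V\<close> becomes a restriction to the coordinates in \<open>D\<close>.\<close>

lemma isometry_onto_subspace:
  fixes V :: "'a::euclidean_space set"
  assumes V: "subspace V"
  shows "\<exists>(f :: 'a \<Rightarrow> 'a) D. linear f \<and> (\<forall>x. norm (f x) = norm x) \<and> D \<subseteq> Basis \<and> card D = dim V
    \<and> (\<forall>x. (norm (orth_proj V (f x)))\<^sup>2 = (\<Sum>b\<in>D. (x \<bullet> b)\<^sup>2))"
proof -
  define W where "W = {y. \<forall>x\<in>V. orthogonal x y}"
  have W: "subspace W"
    by (auto simp: W_def subspace_def orthogonal_def inner_simps)
  obtain B where B: "B \<subseteq> V" "pairwise orthogonal B" "\<And>x. x \<in> B \<Longrightarrow> norm x = 1"
      "independent B" "card B = dim V"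
    using orthonormal_basis_subspace[OF V] by metis
  obtain C where C: "C \<subseteq> W" "pairwise orthogonal C" "\<And>x. x \<in> C \<Longrightarrow> norm x = 1"
      "independent C" "card C = dim W"
    using orthonormal_basis_subspace[OF W] by metis
  have fin: "finite B" "finite C" using B(4) C(4) by (auto simp: independent_imp_finite)
  have BC: "orthogonal b c" if "b \<in> B" "c \<in> C" for b c
    using that B(1) C(1) by (auto simp: W_def)
  have disj: "B \<inter> C = {}"
    using BC B(3) by (metis disjoint_iff norm_eq_zero orthogonal_self zero_neq_one)
  have orth: "pairwise orthogonal (B \<union> C)"
    using B(2) C(2) BC unfolding pairwise_def by (metis UnE orthogonal_commute)
  have "dim W + dim V = DIM('a)"
    using dim_subspace_orthogonal_to_vectors[OF V subspace_UNIV] unfolding W_def by simp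
  moreover have "card (B \<union> C) = dim V + dim W"
    using card_Un_disjoint[OF fin disj] B(5) C(5) by simp
  ultimately have "card (Basis :: 'a set) = card (B \<union> C)" by simp
  then obtain h where h: "bij_betw h (Basis :: 'a set) (B \<union> C)"
    using bij_betw_iff_card[OF finite_Basis finite_UnI[OF fin]] by blast
  define f where "f x = (\<Sum>b\<in>Basis. (x \<bullet> b) *\<^sub>R h b)" for x
  define D where "D = {b \<in> Basis. h b \<in> B}"
  have hn: "norm (h b) = 1" if "b \<in> Basis" for b
    using that h B(3) C(3) by (auto simp: bij_betw_def)
  have ho: "pairwise (\<lambda>a b. orthogonal ((x \<bullet> a) *\<^sub>R h a) ((x \<bullet> b) *\<^sub>R h b)) Basis" for x :: 'a
  proof (rule pairwiseI)
    fix a b :: 'a assume ab: "a \<in> Basis" "b \<in> Basis" "a \<noteq> b"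
    then have "h a \<noteq> h b" "h a \<in> B \<union> C" "h b \<in> B \<union> C"
      using h by (auto simp: bij_betw_def inj_on_def)
    then have "orthogonal (h a) (h b)" using orth by (simp add: pairwise_def)
    then show "orthogonal ((x \<bullet> a) *\<^sub>R h a) ((x \<bullet> b) *\<^sub>R h b)"
      by (simp add: orthogonal_def)
  qed
  have sq: "(norm (\<Sum>b\<in>E. (x \<bullet> b) *\<^sub>R h b))\<^sup>2 = (\<Sum>b\<in>E. (x \<bullet> b)\<^sup>2)" if "E \<subseteq> Basis" for x and E :: "'a set"
    using that finite_subset[OF that finite_Basis]
    by (subst norm_sum_Pythagorean) (auto simp: hn power_mult_distrib intro!: sum.cong pairwise_subset[OF ho that])
  have lin: "linear f"
    unfolding f_def by (intro linearI) (auto simp: inner_simps scaleR_add_left sum.distrib scaleR_sum_right)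
  have "(norm (f x))\<^sup>2 = (norm x)\<^sup>2" for x
    unfolding f_def norm_square_sum_Basis[of x] by (rule sq) simp
  then have iso: "norm (f x) = norm x" for x
    by (metis norm_ge_zero power2_eq_imp_eq)
  have "bij_betw h D B"
    using h unfolding D_def bij_betw_def by (auto simp: inj_on_def)
  then have cD: "card D = dim V" using B(5) by (simp add: bij_betw_same_card)
  have proj: "orth_proj V (f x) = (\<Sum>b\<in>D. (x \<bullet> b) *\<^sub>R h b)" for x
  proof (rule orth_proj_eqI[OF V])
    show "(\<Sum>b\<in>D. (x \<bullet> b) *\<^sub>R h b) \<in> V"
      using B(1) by (intro subspace_sum V subspace_scale) (auto simp: D_def)
    fix w assume w: "w \<in> V"
    have "f x - (\<Sum>b\<in>D. (x \<bullet> b) *\<^sub>R h b) = (\<Sum>b\<in>Basis - D. (x \<bullet> b) *\<^sub>R h b)"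
      unfolding f_def by (subst sum_diff) (auto simp: D_def)
    also have "\<dots> \<in> W"
    proof (intro subspace_sum W subspace_scale)
      fix b assume "b \<in> Basis - D"
      then have "h b \<in> C" using h by (auto simp: D_def bij_betw_def)
      then show "h b \<in> W" using C(1) by auto
    qed
    finally show "orthogonal (f x - (\<Sum>b\<in>D. (x \<bullet> b) *\<^sub>R h b)) w"
      using w by (auto simp: W_def orthogonal_commute)
  qed
  have "(norm (orth_proj V (f x)))\<^sup>2 = (\<Sum>b\<in>D. (x \<bullet> b)\<^sup>2)" for x
    unfolding proj by (rule sq) (auto simp: D_def)
  moreover have "D \<subseteq> Basis" by (auto simp: D_def)
  ultimately show ?thesis using lin iso cD by blast
qed

text \<open>The value of the Laplace transform of a chi-square variable with \<open>dim V\<close> degrees of freedom: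
  after a rotation the integrand is a product over coordinates, of which \<open>dim V\<close> contribute.\<close>

lemma nn_integral_gauss_exp_proj:
  fixes V :: "'a::euclidean_space set"
  assumes V: "subspace V" and c: "c \<ge> 0"
  shows "(\<integral>\<^sup>+x. ennreal (exp (- c * (norm (orth_proj V x))\<^sup>2)) \<partial>gauss)
       = ennreal ((1 / sqrt (1 + 2 * c)) ^ dim V)"
proof -
  obtain f :: "'a \<Rightarrow> 'a" and D where f: "linear f" "\<And>x. norm (f x) = norm x" and D: "D \<subseteq> Basis" "card D = dim V"
    and fD: "\<And>x. (norm (orth_proj V (f x)))\<^sup>2 = (\<Sum>b\<in>D. (x \<bullet> b)\<^sup>2)"
    using isometry_onto_subspace[OF V] by blast
  have [measurable]: "orth_proj V \<in> borel_measurable borel"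
    by (intro borel_measurable_linear linear_orth_proj V)
  define g :: "'a \<Rightarrow> real \<Rightarrow> ennreal"
    where "g b t = (if b \<in> D then ennreal (exp (- c * t\<^sup>2)) else 1)" for b t
  have gm: "g b \<in> borel_measurable borel" for b
    unfolding g_def by (cases "b \<in> D") simp_all
  have "(\<integral>\<^sup>+x. ennreal (exp (- c * (norm (orth_proj V x))\<^sup>2)) \<partial>gauss)
      = (\<integral>\<^sup>+x. ennreal (exp (- c * (norm (orth_proj V (f x)))\<^sup>2)) \<partial>gauss)"
    by (rule nn_integral_gauss_isometry[OF f, symmetric]) measurable
  also have "\<dots> = (\<integral>\<^sup>+x. (\<Prod>b\<in>Basis. g b (x \<bullet> b)) \<partial>gauss)"
  proof (rule nn_integral_cong)
    fix x :: 'a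
    have "(\<Prod>b\<in>Basis. g b (x \<bullet> b)) = (\<Prod>b\<in>D. ennreal (exp (- c * (x \<bullet> b)\<^sup>2)))"
      unfolding g_def using D(1) by (subst prod.inter_restrict[symmetric]) (auto simp: Int_absorb1)
    also have "\<dots> = ennreal (exp (- c * (\<Sum>b\<in>D. (x \<bullet> b)\<^sup>2)))"
      using finite_subset[OF D(1)]
      by (subst prod_ennreal) (auto simp: exp_sum sum_distrib_left sum_negf[symmetric])
    finally show "ennreal (exp (- c * (norm (orth_proj V (f x)))\<^sup>2)) = (\<Prod>b\<in>Basis. g b (x \<bullet> b))"
      by (simp add: fD)
  qed
  also have "\<dots> = (\<Prod>b\<in>Basis. if b \<in> D then ennreal (1 / sqrt (1 + 2 * c)) else 1)"
  proof (subst nn_integral_gauss_prod)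
    show "(\<Prod>b\<in>Basis. \<integral>\<^sup>+t. ennreal (std_normal_density t) * g b t \<partial>lborel)
        = (\<Prod>b\<in>Basis. if b \<in> D then ennreal (1 / sqrt (1 + 2 * c)) else 1)"
    proof (rule prod.cong[OF refl])
      fix b
      show "(\<integral>\<^sup>+t. ennreal (std_normal_density t) * g b t \<partial>lborel)
          = (if b \<in> D then ennreal (1 / sqrt (1 + 2 * c)) else 1)"
        using nn_integral_std_normal_exp_square[OF c]
        by (cases "b \<in> D") (simp_all add: g_def nn_integral_normal_density)
    qed
  qed (rule gm)
  also have "\<dots> = ennreal (1 / sqrt (1 + 2 * c)) ^ dim V"
    using D by (subst prod.inter_restrict[symmetric]) (auto simp: Int_absorb1)
  also have "\<dots> = ennreal ((1 / sqrt (1 + 2 * c)) ^ dim V)"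
    using c by (simp add: ennreal_power)
  finally show ?thesis .
qed

lemma AE_gauss_not_in_subspace:
  fixes S :: "'a::euclidean_space set"
  assumes S: "subspace S" and "dim S < DIM('a)"
  shows "AE x in gauss. x \<notin> S"
proof -
  have "S \<in> sets borel" using S by (simp add: closed_subspace)
  moreover have "S \<in> null_sets lebesgue"
    using negligible_lowdim[OF assms(2)] by (simp add: negligible_iff_null_sets)
  ultimately have "S \<in> null_sets lborel"
    by (auto simp: null_sets_def)
  then have "AE x in lborel. x \<notin> S" by (rule AE_not_in)
  then show ?thesis
    unfolding gauss_def by (subst AE_density) auto
qed

section \<open>The columns of a Gaussian ensemble\<close>

lemma borel_measurable_vecI:
  fixes f :: "'w \<Rightarrow> 'a::euclidean_space^'q"
  assumes "\<And>q. (\<lambda>\<omega>. f \<omega> $ q) \<in> borel_measurable M"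
  shows "f \<in> borel_measurable M"
proof (subst borel_measurable_euclidean_space, rule ballI)
  fix b :: "'a^'q" assume "b \<in> Basis"
  then obtain q u where b: "b = axis q u" by (auto simp: Basis_vec_def)
  have [measurable]: "(\<lambda>\<omega>. f \<omega> $ q) \<in> borel_measurable M" by fact
  show "(\<lambda>\<omega>. f \<omega> \<bullet> b) \<in> borel_measurable M" by (simp add: b inner_axis)
qed

lemma Basis_real_vec: "(Basis :: (real^'q) set) = range (\<lambda>q. axis q 1)"
  by (auto simp: Basis_vec_def)

lemma prod_Basis_real_vec:
  "(\<Prod>b\<in>(Basis :: (real^'q) set). F b) = (\<Prod>q\<in>UNIV. F (axis q 1))"
  unfolding Basis_real_vec by (subst prod.reindex) (auto simp: inj_on_def axis_eq_axis)

text \<open>Boxes generate the Borel sets, so this product formula identifies the measure below.\<close>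

lemma emeasure_gauss_box:
  "emeasure gauss (box l u :: 'a::euclidean_space set)
   = (\<Prod>b\<in>Basis. emeasure (density lborel std_normal_density) {l \<bullet> b <..< u \<bullet> b})"
proof -
  have "emeasure gauss (box l u) = (\<integral>\<^sup>+x. indicator (box l u) x \<partial>gauss)" by simp
  also have "\<dots> = (\<integral>\<^sup>+x. (\<Prod>b\<in>Basis. indicator {l \<bullet> b <..< u \<bullet> b} (x \<bullet> b)) \<partial>gauss)"
  proof (rule nn_integral_cong)
    fix x :: 'a
    show "(indicator (box l u) x :: ennreal) = (\<Prod>b\<in>Basis. indicator {l \<bullet> b <..< u \<bullet> b} (x \<bullet> b))"
      by (auto simp: indicator_def box_def)
  qed
  also have "\<dots> = (\<Prod>b\<in>Basis. emeasure (density lborel std_normal_density) {l \<bullet> b <..< u \<bullet> b})"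
    by (subst nn_integral_gauss_prod) (auto simp: emeasure_density)
  finally show ?thesis .
qed

lemma distr_iid_normal_vec:
  fixes X :: "'q::finite \<Rightarrow> 'w \<Rightarrow> real"
  assumes M: "prob_space M"
    and ind: "prob_space.indep_vars M (\<lambda>_. borel) X UNIV"
    and X: "\<And>q. distributed M lborel (X q) std_normal_density"
  shows "distr M borel (\<lambda>\<omega>. \<chi> q. X q \<omega>) = gauss"
proof -
  interpret prob_space M by fact
  interpret g: prob_space "gauss :: (real^'q) measure" by (rule prob_space_gauss)
  have Xm[measurable]: "X q \<in> borel_measurable M" for q
    using distributed_measurable[OF X, of q] by simp
  have vm[measurable]: "(\<lambda>\<omega>. \<chi> q. X q \<omega>) \<in> borel_measurable M"
    by (rule borel_measurable_vecI) simp
  interpret d: prob_space "distr M borel (\<lambda>\<omega>. \<chi> q. X q \<omega>)"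
    by (rule prob_space_distr) simp
  show ?thesis
  proof (rule measure_eqI_generator_eq)
    let ?E = "range (\<lambda>(a, b). box a b :: (real^'q) set)"
    show "Int_stable ?E"
      by (auto simp: Int_stable_def box_Int_box)
    show "?E \<subseteq> Pow UNIV" "sets (distr M borel (\<lambda>\<omega>. \<chi> q. X q \<omega>)) = sigma_sets UNIV ?E"
      "sets gauss = sigma_sets UNIV ?E"
      by (simp_all add: borel_eq_box)
    let ?A = "\<lambda>n::nat. box (- (real n *\<^sub>R One)) (real n *\<^sub>R One) :: (real^'q) set"
    show "range ?A \<subseteq> ?E" "(\<Union>i. ?A i) = UNIV"
      unfolding UN_box_eq_UNIV by auto
    show "emeasure (distr M borel (\<lambda>\<omega>. \<chi> q. X q \<omega>)) (?A i) \<noteq> \<infinity>" for i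
      by simp
    fix Y assume "Y \<in> ?E"
    then obtain l u where Y: "Y = box l u" by auto
    have "emeasure (distr M borel (\<lambda>\<omega>. \<chi> q. X q \<omega>)) Y
        = emeasure M (\<Inter>q\<in>UNIV. X q -` {l $ q <..< u $ q} \<inter> space M)"
      unfolding Y by (subst emeasure_distr) (auto simp: mem_box_cart intro!: arg_cong[where f = "emeasure M"])
    also have "\<dots> = ennreal (\<Prod>q\<in>UNIV. prob (X q -` {l $ q <..< u $ q} \<inter> space M))"
      unfolding emeasure_eq_measure by (subst indep_varsD[OF ind]) auto
    also have "\<dots> = (\<Prod>q\<in>UNIV. emeasure M (X q -` {l $ q <..< u $ q} \<inter> space M))"
      unfolding emeasure_eq_measure by (subst prod_ennreal) auto
    also have "\<dots> = (\<Prod>q\<in>UNIV. emeasure (density lborel std_normal_density) {l $ q <..< u $ q})"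
      by (intro prod.cong refl, subst distributed_distr_eq_density[OF X, symmetric], subst emeasure_distr) auto
    also have "\<dots> = emeasure gauss Y"
      unfolding Y emeasure_gauss_box prod_Basis_real_vec by (simp add: inner_axis)
    finally show "emeasure (distr M borel (\<lambda>\<omega>. \<chi> q. X q \<omega>)) Y = emeasure gauss Y" .
  qed
qed

text \<open>Grouping the independent entries by column gives independent columns, and each column has
  independent standard normal entries.\<close>

lemma distr_columns_gaussian_ensemble:
  fixes \<Phi> :: "'w \<Rightarrow> real^'n^'q"
  assumes "std_gaussian_ensemble M \<Phi>"
  shows "distr M (PiM UNIV (\<lambda>_. borel)) (\<lambda>\<omega> n. column n (\<Phi> \<omega>)) = PiM UNIV (\<lambda>_. gauss)"
proof -
  have M: "prob_space M"
    and ind: "prob_space.indep_vars M (\<lambda>_. borel) (\<lambda>(q, n) \<omega>. \<Phi> \<omega> $ q $ n) (UNIV :: ('q \<times> 'n) set)"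
    and X: "\<And>q n. distributed M lborel (\<lambda>\<omega>. \<Phi> \<omega> $ q $ n) std_normal_density"
    using assms by (auto simp: std_gaussian_ensemble_def)
  interpret prob_space M by fact
  have rv[measurable]: "(\<lambda>\<omega>. \<Phi> \<omega> $ q $ n) \<in> borel_measurable M" for q n
    using distributed_measurable[OF X, of q n] by simp
  have col[measurable]: "(\<lambda>\<omega>. column n (\<Phi> \<omega>)) \<in> borel_measurable M" for n
    unfolding column_def by (rule borel_measurable_vecI) simp
  have "distr M borel (\<lambda>\<omega>. \<chi> q. \<Phi> \<omega> $ q $ n) = gauss" for n
  proof (rule distr_iid_normal_vec[OF M _ X])
    \<comment> \<open>The entries of one column are reindexed by rows through singleton groups.\<close>
    have "indep_vars (\<lambda>q. PiM {(q, n)} (\<lambda>_. borel))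
        (\<lambda>q \<omega>. restrict (\<lambda>i. (case i of (q, n) \<Rightarrow> \<lambda>\<omega>. \<Phi> \<omega> $ q $ n) \<omega>) {(q, n)}) (UNIV :: 'q set)"
      by (rule indep_vars_restrict[OF ind]) (auto simp: disjoint_family_on_def)
    then have "indep_vars (\<lambda>_. borel)
        (\<lambda>q \<omega>. (\<lambda>f. f (q, n))
          (restrict (\<lambda>i. (case i of (q, n) \<Rightarrow> \<lambda>\<omega>. \<Phi> \<omega> $ q $ n) \<omega>) {(q, n)})) (UNIV :: 'q set)"
      by (rule indep_vars_compose2) simp
    then show "indep_vars (\<lambda>_. borel) (\<lambda>q \<omega>. \<Phi> \<omega> $ q $ n) UNIV"
      by simp
  qed
  then have law: "distr M borel (\<lambda>\<omega>. column n (\<Phi> \<omega>)) = gauss" for n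
    by (simp add: column_def)
  have "indep_vars (\<lambda>n. PiM (UNIV \<times> {n}) (\<lambda>_. borel))
      (\<lambda>n \<omega>. restrict (\<lambda>i. (case i of (q, n) \<Rightarrow> \<lambda>\<omega>. \<Phi> \<omega> $ q $ n) \<omega>) (UNIV \<times> {n})) (UNIV :: 'n set)"
    by (rule indep_vars_restrict[OF ind]) (auto simp: disjoint_family_on_def)
  then have "indep_vars (\<lambda>_. borel)
      (\<lambda>n \<omega>. (\<lambda>f. (\<chi> q. f (q, n)) :: real^'q)
        (restrict (\<lambda>i. (case i of (q, n) \<Rightarrow> \<lambda>\<omega>. \<Phi> \<omega> $ q $ n) \<omega>) (UNIV \<times> {n}))) (UNIV :: 'n set)"
    by (rule indep_vars_compose2) (rule borel_measurable_vecI, simp)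
  then have "indep_vars (\<lambda>_. borel) (\<lambda>n \<omega>. column n (\<Phi> \<omega>)) (UNIV :: 'n set)"
    by (simp add: column_def)
  then show ?thesis
    by (subst (asm) indep_vars_iff_distr_eq_PiM) (simp_all add: law restrict_UNIV)
qed

section \<open>The criterion as a sign condition on projected columns\<close>

lemma sat_supp_nonempty: "sat_supp x \<noteq> {}"
proof -
  have "infnorm x \<in> (\<lambda>b. \<bar>x \<bullet> b\<bar>) ` Basis"
    unfolding infnorm_Max by (rule Max_in) auto
  then obtain i where "infnorm x = \<bar>x $ i\<bar>"
    by (auto simp: Basis_vec_def inner_axis)
  then show ?thesis by (auto simp: sat_supp_def)
qed

lemma card_sat_supp_pos: "card (sat_supp x) > 0"
  using sat_supp_nonempty[of x] by (simp add: card_gt_0_iff)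

lemma sat_sign_square:
  assumes "x \<noteq> 0" "i \<in> sat_supp x"
  shows "sat_sign x $ i * sat_sign x $ i = 1"
proof -
  have "\<bar>x $ i\<bar> > 0"
    using assms infnorm_pos_lt[of x] by (simp add: sat_supp_def)
  then show ?thesis using assms(2) by (auto simp: sat_sign_def sgn_if)
qed

lemma sat_sign_outside: "i \<notin> sat_supp x \<Longrightarrow> sat_sign x $ i = 0"
  by (simp add: sat_sign_def)

lemma sat_sign_in_model_space: "sat_sign x \<in> model_space x"
  by (auto simp: model_space_def intro!: exI[of _ 1])

lemma axis_in_model_space: "i \<notin> sat_supp x \<Longrightarrow> axis i 1 \<in> model_space x"
  by (auto simp: model_space_def axis_def intro!: exI[of _ 0])

lemma model_space_decomp:
  assumes "t \<in> model_space x"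
  shows "\<exists>\<rho> t'. t = \<rho> *\<^sub>R sat_sign x + t' \<and> (\<forall>i\<in>sat_supp x. t' $ i = 0)"
proof -
  obtain \<rho> where r: "\<forall>i\<in>sat_supp x. t $ i = \<rho> * sat_sign x $ i"
    using assms by (auto simp: model_space_def)
  show ?thesis
    by (rule exI[of _ \<rho>], rule exI[of _ "t - \<rho> *\<^sub>R sat_sign x"]) (use r in auto)
qed

lemma matrix_vector_mult_axis: "(A :: real^'n^'q) *v axis i 1 = column i A"
  by (simp add: matrix_vector_mult_basis)

lemma inner_sat_sign:
  assumes "x \<noteq> 0"
  shows "sat_sign x \<bullet> sat_sign x = real (card (sat_supp x))"
proof -
  have "sat_sign x \<bullet> sat_sign x = (\<Sum>i\<in>UNIV. if i \<in> sat_supp x then 1 else 0)"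
    unfolding inner_vec_def
    by (intro sum.cong) (auto simp: sat_sign_square[OF assms] sat_sign_outside)
  also have "\<dots> = real (card (sat_supp x))" by (simp add: sum.If_cases)
  finally show ?thesis .
qed

text \<open>The model vector reads off the coefficient of the sign vector; the factor \<open>1 / |I|\<close> in its
  definition is the normalisation that makes this coefficient exact.\<close>

lemma inner_model_vector:
  assumes "x \<noteq> 0" "\<And>i. i \<in> sat_supp x \<Longrightarrow> t' $ i = 0"
  shows "model_vector x \<bullet> (\<rho> *\<^sub>R sat_sign x + t') = \<rho>"
proof -
  have "sat_sign x \<bullet> t' = 0"
    unfolding inner_vec_def using assms(2) by (intro sum.neutral) (auto simp: sat_sign_def)
  then show ?thesis
    using inner_sat_sign[OF assms(1)] card_sat_supp_pos[of x]
    by (simp add: model_vector_def inner_simps sat_supp_nonempty)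
qed

lemma proj_matrix_mult: "subspace V \<Longrightarrow> proj_matrix V *v v = orth_proj V v"
  by (simp add: proj_matrix_def matrix_works linear_orth_proj)

lemma orth_proj_id: "subspace V \<Longrightarrow> v \<in> V \<Longrightarrow> orth_proj V v = v"
  by (rule orth_proj_eqI) (auto simp: orthogonal_def)

lemma restr_mult: "subspace V \<Longrightarrow> restr \<Phi> V *v v = \<Phi> *v orth_proj V v"
  by (simp add: restr_def matrix_vector_mul_assoc[symmetric] proj_matrix_mult)

lemma inner_transpose_mult: "(transpose A *v u) \<bullet> v = u \<bullet> ((A :: real^'n^'q) *v v)"
  by (simp add: transpose_matrix_vector dot_lmul_matrix)

lemma orth_proj_axis_complement:
  assumes x: "x \<noteq> 0" and i: "i \<in> sat_supp x"
  shows "orth_proj ((model_space x)\<^sup>\<bottom>) (axis i 1)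
       = axis i 1 - (sat_sign x $ i / real (card (sat_supp x))) *\<^sub>R sat_sign x"
proof (rule orth_proj_eqI[OF subspace_orthogonal_comp])
  let ?c = "sat_sign x $ i / real (card (sat_supp x))"
  show "axis i 1 - ?c *\<^sub>R sat_sign x \<in> (model_space x)\<^sup>\<bottom>"
    unfolding orthogonal_comp_def
  proof (intro CollectI ballI)
    fix t assume "t \<in> model_space x"
    then obtain \<rho> t' where t: "t = \<rho> *\<^sub>R sat_sign x + t'" "\<And>i. i \<in> sat_supp x \<Longrightarrow> t' $ i = 0"
      using model_space_decomp by blast
    have "?c *\<^sub>R sat_sign x = sat_sign x $ i *\<^sub>R model_vector x"
      by (simp add: model_vector_def)
    then have "(?c *\<^sub>R sat_sign x) \<bullet> t = sat_sign x $ i * \<rho>"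
      using inner_model_vector[OF x t(2)] by (simp add: t(1))
    moreover have "axis i 1 \<bullet> t = \<rho> * sat_sign x $ i"
      using t i by (simp add: inner_axis' )
    ultimately show "orthogonal t (axis i 1 - ?c *\<^sub>R sat_sign x)"
      by (simp add: orthogonal_def inner_diff_right inner_commute[of t])
  qed
  fix w assume "w \<in> (model_space x)\<^sup>\<bottom>"
  then have "orthogonal (sat_sign x) w"
    using sat_sign_in_model_space[of x] by (auto simp: orthogonal_comp_def)
  then show "orthogonal (axis i 1 - (axis i 1 - ?c *\<^sub>R sat_sign x)) w"
    by (simp add: orthogonal_def)
qed

text \<open>The projection formula above gives \<open>\<eta>\<^sub>i = u \<bullet> c\<^sub>i - s\<^sub>i / |I|\<close>, where the normalisation
  \<open>u \<bullet> \<Phi> s = 1\<close> enters; so the \<open>i\<close>-th term in the gauge equals \<open>1 - |I| s\<^sub>i (u \<bullet> c\<^sub>i)\<close>.\<close>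

lemma IC_less_one_iff_dual_signs:
  fixes \<Phi> :: "real^'n^'q"
  assumes "x \<noteq> 0"
  defines "u \<equiv> transpose (pinv (restr \<Phi> (model_space x))) *v model_vector x"
  assumes us: "u \<bullet> (\<Phi> *v sat_sign x) = 1"
  shows "IC \<Phi> x < 1 \<longleftrightarrow> (\<forall>i\<in>sat_supp x. sat_sign x $ i * (u \<bullet> column i \<Phi>) > 0)"
proof -
  let ?I = "sat_supp x" and ?s = "sat_sign x"
  let ?k = "real (card ?I)"
  define \<eta> where "\<eta> = transpose (restr \<Phi> ((model_space x)\<^sup>\<bottom>)) *v u"
  have k: "?k > 0" using card_sat_supp_pos[of x] by simp
  have eta: "\<eta> $ i = u \<bullet> column i \<Phi> - ?s $ i / ?k" if i: "i \<in> ?I" for i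
  proof -
    have "\<eta> $ i = \<eta> \<bullet> axis i 1" by (simp add: inner_axis)
    also have "\<dots> = u \<bullet> (\<Phi> *v orth_proj ((model_space x)\<^sup>\<bottom>) (axis i 1))"
      unfolding \<eta>_def inner_transpose_mult by (simp add: restr_mult subspace_orthogonal_comp)
    also have "\<dots> = u \<bullet> column i \<Phi> - ?s $ i / ?k"
      using us by (simp add: orth_proj_axis_complement[OF assms(1) i] matrix_vector_mult_diff_distrib
          matrix_vector_mult_axis matrix_vector_mult_scaleR inner_simps)
    finally show ?thesis .
  qed
  have "IC \<Phi> x < 1 \<longleftrightarrow> (\<forall>i\<in>?I. max 0 (- ?k * ?s $ i * \<eta> $ i) < 1)"
    unfolding IC_def subdiff_gauge_def \<eta>_def u_def
    by (subst Max_less_iff) (auto simp: sat_supp_nonempty)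
  also have "\<dots> \<longleftrightarrow> (\<forall>i\<in>?I. ?s $ i * (u \<bullet> column i \<Phi>) > 0)"
  proof (rule ball_cong[OF refl])
    fix i assume i: "i \<in> ?I"
    have "- ?k * ?s $ i * \<eta> $ i = ?s $ i * ?s $ i - ?k * (?s $ i * (u \<bullet> column i \<Phi>))"
    proof -
      have "- K * p * (q - p / K) = p * p - K * (p * q)" if "K > 0" for K p q :: real
        using that by (simp add: field_simps)
      from this[OF k] show ?thesis by (simp only: eta[OF i])
    qed
    then have "- ?k * ?s $ i * \<eta> $ i = 1 - ?k * (?s $ i * (u \<bullet> column i \<Phi>))"
      by (simp only: sat_sign_square[OF assms(1) i])
    then show "max 0 (- ?k * ?s $ i * \<eta> $ i) < 1 \<longleftrightarrow> ?s $ i * (u \<bullet> column i \<Phi>) > 0"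
      using k by (auto simp: zero_less_mult_iff)
  qed
  finally show ?thesis .
qed

text \<open>Let \<open>A\<close> be the restricted matrix and \<open>B\<close> its pseudo-inverse.  By the Penrose equations, the transpose of \<open>B\<close> equals \<open>A B\<close> times the transpose of \<open>B\<close>, so its image lies in the range
  of \<open>A\<close>; and \<open>A B A = A\<close> says, by injectivity of \<open>\<Phi>\<close> on the model space, that \<open>B A\<close> acts as
  the identity there up to a component orthogonal to it.\<close>

lemma dual_certificate:
  assumes "IC_defined \<Phi> x"
  defines "u \<equiv> transpose (pinv (restr \<Phi> (model_space x))) *v model_vector x"
  shows "\<exists>t\<in>model_space x. u = \<Phi> *v t"
    and "t \<in> model_space x \<Longrightarrow> u \<bullet> (\<Phi> *v t) = model_vector x \<bullet> t"
proof -
  let ?T = "model_space x"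
  define A B where "A = restr \<Phi> ?T" and "B = pinv A"
  have mp: "A ** B ** A = A" "B ** A ** B = B" "transpose (A ** B) = A ** B" "transpose (B ** A) = B ** A"
    using moore_penrose_pinv[of A] by (auto simp: moore_penrose_def B_def)
  have Av: "A *v v = \<Phi> *v orth_proj ?T v" for v
    by (simp add: A_def restr_mult subspace_model_space)
  have u: "u = transpose B *v model_vector x" by (simp add: u_def A_def B_def)
  have "transpose B = transpose (A ** B) ** transpose B"
    using mp(2) by (metis matrix_mul_assoc matrix_transpose_mul)
  then have "transpose B = A ** B ** transpose B" by (simp only: mp(3))
  then have "u = A *v (B *v (transpose B *v model_vector x))"
    unfolding u by (metis matrix_vector_mul_assoc)
  then show "\<exists>t\<in>?T. u = \<Phi> *v t"
    using orth_proj_in[OF subspace_model_space] by (auto simp: Av)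
  assume t: "t \<in> ?T"
  have "A *v (B *v (A *v t)) = A *v t" using mp(1) by (metis matrix_vector_mul_assoc)
  then have "\<Phi> *v (orth_proj ?T (B *v (A *v t)) - t) = 0"
    by (simp add: Av orth_proj_id[OF subspace_model_space t] matrix_vector_mult_diff_distrib)
  moreover have "orth_proj ?T (B *v (A *v t)) - t \<in> ?T"
    by (intro subspace_diff subspace_model_space orth_proj_in t)
  ultimately have "orth_proj ?T (B *v (A *v t)) - t \<in> {0}"
    using assms unfolding IC_defined_def by blast
  then have P: "orth_proj ?T (B *v (A *v t)) = t" by simp
  have e: "model_vector x \<in> ?T"
    unfolding model_vector_def by (intro subspace_scale subspace_model_space sat_sign_in_model_space)
  have "u \<bullet> (\<Phi> *v t) = u \<bullet> (A *v t)" by (simp add: Av orth_proj_id[OF subspace_model_space t])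
  also have "\<dots> = model_vector x \<bullet> (B *v (A *v t))" unfolding u by (rule inner_transpose_mult)
  also have "\<dots> = orth_proj ?T (model_vector x) \<bullet> (B *v (A *v t))"
    by (simp add: orth_proj_id[OF subspace_model_space e])
  also have "\<dots> = model_vector x \<bullet> t" by (simp add: orth_proj_sym subspace_model_space P)
  finally show "u \<bullet> (\<Phi> *v t) = model_vector x \<bullet> t" .
qed

lemma matrix_mult_sat_sign:
  "\<Phi> *v sat_sign x = (\<Sum>i\<in>sat_supp x. sat_sign x $ i *\<^sub>R column i \<Phi>)" for \<Phi> :: "real^'n^'q"
proof -
  have "\<Phi> *v sat_sign x = (\<Sum>i\<in>UNIV. sat_sign x $ i *\<^sub>R column i \<Phi>)"
    by (simp add: matrix_mult_sum scalar_mult_eq_scaleR)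
  also have "\<dots> = (\<Sum>i\<in>sat_supp x. sat_sign x $ i *\<^sub>R column i \<Phi>)"
    by (rule sum.mono_neutral_right) (auto simp: sat_sign_outside)
  finally show ?thesis .
qed

lemma matrix_mult_off_supp:
  fixes \<Phi> :: "real^'n^'q"
  assumes "\<And>i. i \<in> I \<Longrightarrow> t $ i = 0"
  shows "\<Phi> *v t = (\<Sum>j\<in>-I. t $ j *\<^sub>R column j \<Phi>)"
proof -
  have "\<Phi> *v t = (\<Sum>i\<in>UNIV. t $ i *\<^sub>R column i \<Phi>)"
    by (simp add: matrix_mult_sum scalar_mult_eq_scaleR)
  also have "\<dots> = (\<Sum>j\<in>-I. t $ j *\<^sub>R column j \<Phi>)"
    by (rule sum.mono_neutral_right) (use assms in auto)
  finally show ?thesis .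
qed

text \<open>The vector \<open>u\<close> that the pseudo-inverse produces from the model vector witnesses the right-hand
  side.  Conversely, the part of the image of the
  model space that is orthogonal to all columns outside the support is a line, so any witness is
  a positive multiple of \<open>u\<close>.  The existential form avoids the pseudo-inverse, which is what makes
  the event accessible to both measurability and a direct sufficient condition.\<close>

lemma IC_less_one_iff:
  fixes \<Phi> :: "real^'n^'q"
  assumes def: "IC_defined \<Phi> x" and x: "x \<noteq> 0"
  shows "IC \<Phi> x < 1 \<longleftrightarrow>
    (\<exists>t\<in>model_space x. (\<forall>j\<in>- sat_supp x. (\<Phi> *v t) \<bullet> column j \<Phi> = 0) \<and>
       (\<forall>i\<in>sat_supp x. (\<Phi> *v t) \<bullet> (sat_sign x $ i *\<^sub>R column i \<Phi>) > 0))"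
    (is "_ \<longleftrightarrow> (\<exists>t\<in>?T. ?P t)")
proof -
  let ?s = "sat_sign x" and ?I = "sat_supp x"
  define u where "u = transpose (pinv (restr \<Phi> ?T)) *v model_vector x"
  obtain t0 where t0: "t0 \<in> ?T" "u = \<Phi> *v t0"
    using dual_certificate(1)[OF def] by (auto simp: u_def)
  have dual: "u \<bullet> (\<Phi> *v t) = model_vector x \<bullet> t" if "t \<in> ?T" for t
    using dual_certificate(2)[OF def that] by (simp add: u_def)
  have dual': "u \<bullet> (\<Phi> *v (\<rho> *\<^sub>R ?s + t')) = \<rho>"
    if "\<rho> *\<^sub>R ?s + t' \<in> ?T" "\<And>i. i \<in> ?I \<Longrightarrow> t' $ i = 0" for \<rho> t'
    using dual[OF that(1)] inner_model_vector[OF x that(2)] by simp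
  have us: "u \<bullet> (\<Phi> *v ?s) = 1"
    using dual'[of 1 0] sat_sign_in_model_space[of x] by simp
  have uj: "u \<bullet> column j \<Phi> = 0" if "j \<in> - ?I" for j
  proof -
    have "(axis j 1 :: real^'n) $ i = 0" if "i \<in> ?I" for i
      using that \<open>j \<in> - ?I\<close> by (auto simp: axis_def)
    then show ?thesis
      using dual'[of 0 "axis j 1"] that axis_in_model_space[of j x]
      by (auto simp: matrix_vector_mult_axis)
  qed
  have IC: "IC \<Phi> x < 1 \<longleftrightarrow> (\<forall>i\<in>?I. u \<bullet> (?s $ i *\<^sub>R column i \<Phi>) > 0)"
    using IC_less_one_iff_dual_signs[OF x us[unfolded u_def]] by (simp add: u_def)
  show ?thesis
  proof
    assume "IC \<Phi> x < 1"
    then show "\<exists>t\<in>?T. ?P t"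
      using t0 uj unfolding IC by (intro bexI[of _ t0]) auto
  next
    assume "\<exists>t\<in>?T. ?P t"
    then obtain t where t: "t \<in> ?T" and tP: "?P t" by blast
    obtain \<rho> t' where tt: "t = \<rho> *\<^sub>R ?s + t'" "\<And>i. i \<in> ?I \<Longrightarrow> t' $ i = 0"
      using model_space_decomp[OF t] by blast
    obtain \<rho>0 t0' where tt0: "t0 = \<rho>0 *\<^sub>R ?s + t0'" "\<And>i. i \<in> ?I \<Longrightarrow> t0' $ i = 0"
      using model_space_decomp[OF t0(1)] by blast
    define a where "a = (\<Phi> *v t) \<bullet> (\<Phi> *v ?s)"
    have a: "a > 0"
      unfolding a_def matrix_mult_sat_sign inner_sum_right
      using tP by (intro sum_pos) (auto simp: sat_supp_nonempty)
    have off: "(\<Phi> *v t) \<bullet> (\<Phi> *v w) = 0" if "\<And>i. i \<in> ?I \<Longrightarrow> w $ i = 0" for w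
    proof -
      have "\<Phi> *v w = (\<Sum>j\<in>-?I. w $ j *\<^sub>R column j \<Phi>)"
        by (rule matrix_mult_off_supp) (rule that)
      then show ?thesis using tP by (simp add: inner_sum_right)
    qed
    have 1: "(\<Phi> *v t) \<bullet> (\<Phi> *v t) = \<rho> * a"
      by (subst (2) tt(1)) (simp add: matrix_vector_right_distrib matrix_vector_mult_scaleR inner_simps off tt(2) a_def)
    have 2: "(\<Phi> *v t) \<bullet> u = \<rho>0 * a"
      unfolding t0(2)
      by (subst tt0(1)) (simp add: matrix_vector_right_distrib matrix_vector_mult_scaleR inner_simps off tt0(2) a_def)
    have 3: "u \<bullet> (\<Phi> *v t) = \<rho>"
      using dual'[OF _ tt(2), of \<rho>] t tt(1) by auto
    have 4: "u \<bullet> u = \<rho>0"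
      using dual'[OF _ tt0(2), of \<rho>0] t0 tt0(1) by auto
    \<comment> \<open>The squared distance between the witness and \<open>a *\<^sub>R u\<close> expands to zero, which avoids a dimension argument.\<close>
    have "\<rho> = \<rho>0 * a" using 2 3 by (simp add: inner_commute)
    then have "(\<Phi> *v t - a *\<^sub>R u) \<bullet> (\<Phi> *v t - a *\<^sub>R u) = 0"
      unfolding inner_diff_left inner_diff_right inner_scaleR_left inner_scaleR_right 1 2 3 4
      by simp
    then have eq: "\<Phi> *v t = a *\<^sub>R u" by simp
    show "IC \<Phi> x < 1"
      unfolding IC
    proof
      fix i assume "i \<in> ?I"
      with tP have "0 < (a *\<^sub>R u) \<bullet> (?s $ i *\<^sub>R column i \<Phi>)" by (simp only: eq)
      then have "0 < a * (u \<bullet> (?s $ i *\<^sub>R column i \<Phi>))" by (simp only: inner_scaleR_left)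
      then show "0 < u \<bullet> (?s $ i *\<^sub>R column i \<Phi>)" using a by (rule zero_less_mult_pos)
    qed
  qed
qed

text \<open>The orthogonal complement of the span of the columns outside \<open>I\<close>.  It takes the columns as a
  function and ignores those in \<open>I\<close>, so that it stays fixed while the columns in \<open>I\<close> are
  integrated out.\<close>

definition off_support_complement :: "'n set \<Rightarrow> ('n \<Rightarrow> 'a::euclidean_space) \<Rightarrow> 'a set" where
  "off_support_complement I c = {v. \<forall>j\<in>-I. v \<bullet> c j = 0}"

lemma subspace_off_support_complement: "subspace (off_support_complement I c)"
  by (auto simp: off_support_complement_def subspace_def inner_simps)

lemma dim_off_support_complement:
  fixes c :: "'n::finite \<Rightarrow> 'a::euclidean_space"
  shows "DIM('a) \<le> dim (off_support_complement I c) + card (- I)"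
proof -
  let ?W = "span (c ` (- I))"
  have "off_support_complement I c = {y \<in> UNIV. \<forall>x\<in>?W. orthogonal x y}"
  proof (intro equalityI subsetI CollectI conjI ballI)
    fix v w assume v: "v \<in> off_support_complement I c" and w: "w \<in> ?W"
    have "orthogonal v w"
      by (rule orthogonal_to_span[OF w]) (use v in \<open>auto simp: off_support_complement_def orthogonal_def\<close>)
    then show "orthogonal w v" by (simp add: orthogonal_commute)
  next
    fix v assume v: "v \<in> {y \<in> UNIV. \<forall>x\<in>?W. orthogonal x y}"
    have "c j \<in> ?W" if "j \<in> - I" for j using that by (intro span_base) auto
    then show "v \<in> off_support_complement I c"
      using v by (auto simp: off_support_complement_def orthogonal_def inner_commute)
  qed simp
  then have "dim (off_support_complement I c) + dim ?W = DIM('a)"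
    using dim_subspace_orthogonal_to_vectors[of ?W UNIV] by simp
  moreover have "dim ?W \<le> card (- I)"
    unfolding dim_span by (rule order_trans[OF dim_le_card' card_image_le]) auto
  ultimately show ?thesis by simp
qed

text \<open>The projection \<open>w\<close> of \<open>\<Phi> s\<close> differs from \<open>\<Phi> s\<close> by a combination of the columns outside the
  support, so \<open>w\<close> is the image of a vector of the model space and serves as the witness in
  \<open>IC_less_one_iff\<close>.  Summing the correlations shows \<open>w \<bullet> \<Phi> s > 0\<close>; with the linear independence of
  the outer columns this makes \<open>\<Phi>\<close> injective on the model space.\<close>

lemma IC_less_one_if_projected_correlations_pos:
  fixes \<Phi> :: "real^'n^'q"
  assumes x: "x \<noteq> 0"
  defines "V \<equiv> off_support_complement (sat_supp x) (\<lambda>j. column j \<Phi>)"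
  assumes indep: "\<And>t. (\<And>i. i \<in> sat_supp x \<Longrightarrow> t $ i = 0) \<Longrightarrow> \<Phi> *v t = 0 \<Longrightarrow> t = 0"
    and pos: "\<And>i. i \<in> sat_supp x \<Longrightarrow>
        (sat_sign x $ i *\<^sub>R column i \<Phi>) \<bullet> orth_proj V (\<Phi> *v sat_sign x) > 0"
  shows "IC_defined \<Phi> x \<and> IC \<Phi> x < 1"
proof -
  let ?s = "sat_sign x" and ?I = "sat_supp x" and ?T = "model_space x"
  define w where "w = orth_proj V (\<Phi> *v ?s)"
  have V: "subspace V" unfolding V_def by (rule subspace_off_support_complement)
  have wV: "w \<in> V" unfolding w_def by (rule orth_proj_in[OF V])
  have w_col: "w \<bullet> column j \<Phi> = 0" if "j \<notin> ?I" for j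
    using wV that by (auto simp: V_def off_support_complement_def)
  have w_off: "w \<bullet> (\<Phi> *v t) = 0" if "\<And>i. i \<in> ?I \<Longrightarrow> t $ i = 0" for t
    using that w_col by (subst matrix_mult_off_supp[of ?I]) (auto simp: inner_sum_right)
  have ws: "w \<bullet> (\<Phi> *v ?s) > 0"
  proof -
    have "w \<bullet> (\<Phi> *v ?s) = (\<Sum>i\<in>?I. (?s $ i *\<^sub>R column i \<Phi>) \<bullet> w)"
      by (simp only: matrix_mult_sat_sign inner_sum_right inner_commute[of w])
    also have "\<dots> > 0"
      using pos unfolding w_def by (intro sum_pos) (auto simp: sat_supp_nonempty)
    finally show ?thesis .
  qed
  have def: "IC_defined \<Phi> x"
    unfolding IC_defined_def
  proof (intro equalityI subsetI)
    fix t assume "t \<in> {v. \<Phi> *v v = 0} \<inter> ?T"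
    then have t: "t \<in> ?T" "\<Phi> *v t = 0" by auto
    obtain \<rho> t' where tt: "t = \<rho> *\<^sub>R ?s + t'" "\<And>i. i \<in> ?I \<Longrightarrow> t' $ i = 0"
      using model_space_decomp[OF t(1)] by blast
    have "0 = w \<bullet> (\<Phi> *v t)" using t by simp
    also have "\<dots> = \<rho> * (w \<bullet> (\<Phi> *v ?s))"
      by (simp add: tt matrix_vector_right_distrib matrix_vector_mult_scaleR inner_simps w_off)
    finally have "\<rho> = 0" using ws by auto
    then have "t = 0" using indep[of t] t tt by auto
    then show "t \<in> {0}" by simp
  qed (auto intro: subspace_0 subspace_model_space)
  define Z where "Z = {t :: real^'n. \<forall>i\<in>?I. t $ i = 0}"
  define W where "W = (\<lambda>t. \<Phi> *v t) ` Z"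
  have "subspace Z" by (auto simp: Z_def subspace_def)
  then have W: "subspace W"
    unfolding W_def by (intro linear_subspace_image matrix_vector_mul_linear)
  have "V = W\<^sup>\<bottom>"
  proof (intro equalityI subsetI)
    fix v assume v: "v \<in> V"
    have "v \<bullet> (\<Phi> *v t) = 0" if "t \<in> Z" for t
      using v that by (subst matrix_mult_off_supp[of ?I])
        (auto simp: Z_def V_def off_support_complement_def inner_sum_right)
    then show "v \<in> W\<^sup>\<bottom>"
      by (auto simp: W_def orthogonal_comp_def orthogonal_def inner_commute)
  next
    fix v assume v: "v \<in> W\<^sup>\<bottom>"
    have "column j \<Phi> \<in> W" if "j \<in> - ?I" for j
    proof -
      have "axis j 1 \<in> Z" using that by (auto simp: Z_def axis_def)
      then show ?thesis unfolding W_def by (metis image_eqI matrix_vector_mult_axis)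
    qed
    then show "v \<in> V"
      using v by (auto simp: V_def off_support_complement_def orthogonal_comp_def orthogonal_def inner_commute)
  qed
  then have VW: "V\<^sup>\<bottom> = W" by (simp add: orthogonal_comp_self W)
  have "\<Phi> *v ?s - w \<in> V\<^sup>\<bottom>"
    using orth_proj_orthogonal[OF V] by (auto simp: orthogonal_comp_def w_def orthogonal_commute)
  then obtain r where r: "r \<in> Z" "\<Phi> *v ?s - w = \<Phi> *v r" by (auto simp: VW W_def)
  then have "\<Phi> *v (?s - r) = w"
    by (simp add: matrix_vector_mult_diff_distrib algebra_simps)
  moreover have "?s - r \<in> ?T"
    using r(1) by (auto simp: Z_def model_space_def intro!: exI[of _ 1])
  ultimately have "IC \<Phi> x < 1"
    unfolding IC_less_one_iff[OF def x] using w_col pos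
    by (intro bexI[of _ "?s - r"]) (auto simp: w_def inner_commute)
  with def show ?thesis ..
qed

section \<open>Measurability of the criterion\<close>

text \<open>Projections of Borel sets need not be Borel, but a closed set is a countable union of pieces with
  compact first coordinate, and projecting along a compact factor preserves closedness.\<close>

lemma borel_exists_of_closed:
  fixes T :: "('a::euclidean_space \<times> 'b::euclidean_space) set"
  assumes "closed T"
  shows "{y. \<exists>x. (x, y) \<in> T} \<in> sets borel"
proof -
  have "{y. \<exists>x. (x, y) \<in> T} = (\<Union>n::nat. {y. \<exists>x. x \<in> cball 0 (real n) \<and> (x, y) \<in> T})"
    by (auto, metis real_arch_simple)
  moreover have "{y. \<exists>x. x \<in> cball 0 (real n) \<and> (x, y) \<in> T} \<in> sets borel" for n
    by (intro borel_closed closed_compact_projection compact_cball assms)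
  ultimately show ?thesis by simp
qed

lemma continuous_on_matrix_vector_mult [continuous_intros]:
  fixes A :: "'a::topological_space \<Rightarrow> real^'n^'q"
  assumes "continuous_on S A" "continuous_on S v"
  shows "continuous_on S (\<lambda>x. A x *v v x)"
  unfolding matrix_vector_mult_def
  by (intro continuous_intros assms)

lemma continuous_on_column [continuous_intros]:
  fixes A :: "'a::topological_space \<Rightarrow> real^'n^'q"
  assumes "continuous_on S A"
  shows "continuous_on S (\<lambda>x. column j (A x))"
  unfolding column_def by (intro continuous_intros assms)

lemma closed_Collect_in:
  assumes "closed S" "continuous_on UNIV f"
  shows "closed {x. f x \<in> S}"
  using closed_vimage[OF assms] by (simp add: vimage_def)

lemma closed_Collect_ball:
  assumes "\<And>i. i \<in> I \<Longrightarrow> closed {x. P i x}"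
  shows "closed {x. \<forall>i\<in>I. P i x}"
proof -
  have "{x. \<forall>i\<in>I. P i x} = (\<Inter>i\<in>I. {x. P i x})" by auto
  then show ?thesis using assms by auto
qed

text \<open>By homogeneity, the criterion is undefined iff the kernel contains a unit vector of the model
  space, a closed condition on the pair.  Strict positivity of the correlations is the union over
  \<open>n\<close> of the closed conditions with lower bound \<open>1 / Suc n\<close>.\<close>

lemma sets_borel_IC_less_one:
  fixes x :: "real^'n"
  assumes x: "x \<noteq> 0"
  shows "{\<Phi> :: real^'n^'q. IC_defined \<Phi> x \<and> IC \<Phi> x < 1} \<in> sets borel"
proof -
  let ?T = "model_space x" and ?I = "sat_supp x" and ?s = "sat_sign x"
  have T: "closed ?T" by (rule closed_subspace[OF subspace_model_space])
  define K where "K = {p :: (real^'n) \<times> (real^'n^'q). fst p \<in> ?T \<and> norm (fst p) = 1 \<and> snd p *v fst p = 0}"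
  have K: "closed K" unfolding K_def
    by (intro closed_Collect_conj closed_Collect_in[OF T] closed_Collect_eq continuous_intros)
  have def: "IC_defined \<Phi> x \<longleftrightarrow> \<not> (\<exists>t. (t, \<Phi>) \<in> K)" for \<Phi> :: "real^'n^'q"
  proof
    assume "IC_defined \<Phi> x"
    then have "t = 0" if "t \<in> ?T" "\<Phi> *v t = 0" for t
      using that unfolding IC_defined_def by blast
    then show "\<not> (\<exists>t. (t, \<Phi>) \<in> K)" unfolding K_def by fastforce
  next
    assume no: "\<not> (\<exists>t. (t, \<Phi>) \<in> K)"
    have "t = 0" if t: "\<Phi> *v t = 0" "t \<in> ?T" for t
    proof (rule ccontr)
      assume "t \<noteq> 0"
      then have "((1 / norm t) *\<^sub>R t, \<Phi>) \<in> K"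
        using t by (simp add: K_def subspace_scale[OF subspace_model_space] matrix_vector_mult_scaleR)
      with no show False by blast
    qed
    then show "IC_defined \<Phi> x"
      unfolding IC_defined_def using subspace_0[OF subspace_model_space[of x]] by auto
  qed
  define L where "L n = {p :: (real^'n) \<times> (real^'n^'q). fst p \<in> ?T
      \<and> (\<forall>j\<in>-?I. (snd p *v fst p) \<bullet> column j (snd p) = 0)
      \<and> (\<forall>i\<in>?I. 1 / real (Suc n) \<le> (snd p *v fst p) \<bullet> (?s $ i *\<^sub>R column i (snd p)))}" for n
  have L: "closed (L n)" for n unfolding L_def
    by (intro closed_Collect_conj closed_Collect_ball closed_Collect_in[OF T] closed_Collect_eq closed_Collect_le continuous_intros)
  have less: "IC \<Phi> x < 1 \<longleftrightarrow> (\<exists>n t. (t, \<Phi>) \<in> L n)" if "IC_defined \<Phi> x" for \<Phi> :: "real^'n^'q"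
    unfolding IC_less_one_iff[OF that x]
  proof
    assume "\<exists>t\<in>?T. (\<forall>j\<in>-?I. (\<Phi> *v t) \<bullet> column j \<Phi> = 0) \<and> (\<forall>i\<in>?I. (\<Phi> *v t) \<bullet> (?s $ i *\<^sub>R column i \<Phi>) > 0)"
    then obtain t where t: "t \<in> ?T" "\<forall>j\<in>-?I. (\<Phi> *v t) \<bullet> column j \<Phi> = 0"
      "\<forall>i\<in>?I. (\<Phi> *v t) \<bullet> (?s $ i *\<^sub>R column i \<Phi>) > 0" by blast
    define m where "m = Min ((\<lambda>i. (\<Phi> *v t) \<bullet> (?s $ i *\<^sub>R column i \<Phi>)) ` ?I)"
    have "m > 0" unfolding m_def using t(3) by (subst Min_gr_iff) (auto simp: sat_supp_nonempty)
    then obtain n where n: "1 / real (Suc n) < m"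
      using reals_Archimedean by (auto simp: inverse_eq_divide)
    have "m \<le> (\<Phi> *v t) \<bullet> (?s $ i *\<^sub>R column i \<Phi>)" if "i \<in> ?I" for i
      unfolding m_def using that by (intro Min_le) auto
    then have "(t, \<Phi>) \<in> L n" using t n unfolding L_def by fastforce
    then show "\<exists>n t. (t, \<Phi>) \<in> L n" by blast
  next
    assume "\<exists>n t. (t, \<Phi>) \<in> L n"
    then obtain n t where nt: "(t, \<Phi>) \<in> L n" by blast
    have "(\<Phi> *v t) \<bullet> (?s $ i *\<^sub>R column i \<Phi>) > 0" if "i \<in> ?I" for i
    proof -
      have "0 < 1 / real (Suc n)" by simp
      also have "\<dots> \<le> (\<Phi> *v t) \<bullet> (?s $ i *\<^sub>R column i \<Phi>)" using nt that unfolding L_def by simp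
      finally show ?thesis .
    qed
    then show "\<exists>t\<in>?T. (\<forall>j\<in>-?I. (\<Phi> *v t) \<bullet> column j \<Phi> = 0) \<and> (\<forall>i\<in>?I. (\<Phi> *v t) \<bullet> (?s $ i *\<^sub>R column i \<Phi>) > 0)"
      using nt by (intro bexI[of _ t]) (auto simp: L_def)
  qed
  have "{\<Phi>. IC_defined \<Phi> x \<and> IC \<Phi> x < 1} = (\<Union>n. {\<Phi>. \<exists>t. (t, \<Phi>) \<in> L n}) - {\<Phi>. \<exists>t. (t, \<Phi>) \<in> K}"
    using def less by blast
  also have "\<dots> \<in> sets borel"
    by (intro sets.Diff sets.countable_UN borel_exists_of_closed L K subsetI) (auto intro: borel_exists_of_closed L)
  finally show ?thesis .
qed

section \<open>Gaussian columns: independence and correlations\<close>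

lemma product_prob_space_gauss: "product_prob_space (\<lambda>_. gauss)"
  by (intro product_prob_spaceI prob_space_gauss)

text \<open>Given the other columns, their span is a proper subspace and hence a Gaussian null set for
  column \<open>j\<close>.  The coefficients are quantified over a vector space, so that the event is a
  projection of a closed set and Fubini's theorem applies.\<close>

lemma AE_gauss_column_not_in_span:
  fixes J :: "'n::finite set"
  assumes j: "j \<in> J" and J: "card J \<le> DIM('a::euclidean_space)"
  shows "AE c in PiM J (\<lambda>_. gauss :: 'a measure). \<not> (\<exists>t::real^'n. c j = (\<Sum>l\<in>J-{j}. t $ l *\<^sub>R c l))"
proof -
  interpret product_prob_space "\<lambda>_::'n. gauss :: 'a measure" by (rule product_prob_space_gauss)
  let ?K = "J - {j}"
  have JK: "J = insert j ?K" using j by auto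
  define T where "T = {p :: (real^'n) \<times> ('a^'n). snd p $ j = (\<Sum>l\<in>?K. fst p $ l *\<^sub>R snd p $ l)}"
  have T: "closed T" unfolding T_def
    by (intro closed_Collect_eq continuous_intros)
  define mat where "mat c = (\<chi> l. if l \<in> J then c l else (0::'a))" for c :: "'n \<Rightarrow> 'a"
  have mat[measurable]: "mat \<in> borel_measurable (PiM J (\<lambda>_. gauss :: 'a measure))"
    unfolding mat_def
  proof (rule borel_measurable_vecI)
    fix q show "(\<lambda>c. (\<chi> l. if l \<in> J then c l else (0::'a)) $ q) \<in> borel_measurable (PiM J (\<lambda>_. gauss))"
      by (cases "q \<in> J") auto
  qed
  define D where "D c \<longleftrightarrow> (\<exists>t::real^'n. c j = (\<Sum>l\<in>?K. t $ l *\<^sub>R c l))" for c :: "'n \<Rightarrow> 'a"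
  have "D c \<longleftrightarrow> mat c \<in> {y. \<exists>x. (x, y) \<in> T}" for c
    using j by (simp add: D_def T_def mat_def)
  then have "{c \<in> space (PiM J (\<lambda>_. gauss)). D c} = mat -` {y. \<exists>x. (x, y) \<in> T} \<inter> space (PiM J (\<lambda>_. gauss))"
    by auto
  also have "\<dots> \<in> sets (PiM J (\<lambda>_. gauss))"
    by (rule measurable_sets[OF mat borel_exists_of_closed[OF T]])
  finally have D: "{c \<in> space (PiM J (\<lambda>_. gauss)). D c} \<in> sets (PiM J (\<lambda>_. gauss))" (is "?N \<in> _") .
  have "emeasure (PiM J (\<lambda>_. gauss)) ?N = (\<integral>\<^sup>+c. indicator ?N c \<partial>PiM (insert j ?K) (\<lambda>_. gauss))"
    by (simp only: JK[symmetric] nn_integral_indicator[OF D])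
  also have "\<dots> = (\<integral>\<^sup>+c. \<integral>\<^sup>+a. indicator ?N (c(j := a)) \<partial>gauss \<partial>PiM ?K (\<lambda>_. gauss))"
    by (rule product_nn_integral_insert) (use D j in \<open>auto simp: insert_absorb\<close>)
  also have "\<dots> = (\<integral>\<^sup>+c. 0 \<partial>PiM ?K (\<lambda>_. gauss :: 'a measure))"
  proof (rule nn_integral_cong)
    fix c :: "'n \<Rightarrow> 'a"
    have "dim (span (c ` ?K)) \<le> card ?K"
      unfolding dim_span by (rule order_trans[OF dim_le_card' card_image_le]) auto
    also have "card ?K < DIM('a)" using j J card_Diff1_less[OF _ j] by simp
    finally have "AE a in gauss. a \<notin> span (c ` ?K)"
      by (intro AE_gauss_not_in_subspace) auto
    then have "AE a in gauss. indicator ?N (c(j := a)) = (0::ennreal)"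
    proof (eventually_elim)
      fix a assume a: "a \<notin> span (c ` ?K)"
      have "\<not> D (c(j := a))"
      proof
        assume "D (c(j := a))"
        then obtain t :: "real^'n" where "a = (\<Sum>l\<in>?K. t $ l *\<^sub>R c l)" by (auto simp: D_def)
        then have "a \<in> span (c ` ?K)"
          by (auto intro!: span_sum span_scale intro: span_base)
        with a show False ..
      qed
      then show "indicator ?N (c(j := a)) = (0::ennreal)" by simp
    qed
    then have "(\<integral>\<^sup>+a. indicator ?N (c(j := a)) \<partial>gauss) = (\<integral>\<^sup>+a. 0 \<partial>(gauss :: 'a measure))"
      by (rule nn_integral_cong_AE)
    then show "(\<integral>\<^sup>+a. indicator ?N (c(j := a)) \<partial>gauss) = 0" by simp
  qed
  finally have "?N \<in> null_sets (PiM J (\<lambda>_. gauss))" using D by auto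
  then have "AE c in PiM J (\<lambda>_. gauss). c \<notin> ?N" by (rule AE_not_in)
  then show ?thesis using AE_space by eventually_elim (auto simp: D_def)
qed

lemma AE_gauss_columns_independent:
  fixes J :: "'n::finite set"
  assumes J: "card J \<le> DIM('a::euclidean_space)"
  shows "AE c in PiM J (\<lambda>_. gauss :: 'a measure).
    \<forall>t::real^'n. (\<Sum>j\<in>J. t $ j *\<^sub>R c j) = 0 \<longrightarrow> (\<forall>j\<in>J. t $ j = 0)"
proof -
  have "AE c in PiM J (\<lambda>_. gauss :: 'a measure). \<forall>j\<in>J. \<not> (\<exists>t::real^'n. c j = (\<Sum>l\<in>J-{j}. t $ l *\<^sub>R c l))"
    by (intro AE_finite_allI AE_gauss_column_not_in_span J) auto
  then show ?thesis
  proof eventually_elim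
    fix c :: "'n \<Rightarrow> 'a"
    assume c: "\<forall>j\<in>J. \<not> (\<exists>t::real^'n. c j = (\<Sum>l\<in>J-{j}. t $ l *\<^sub>R c l))"
    show "\<forall>t::real^'n. (\<Sum>j\<in>J. t $ j *\<^sub>R c j) = 0 \<longrightarrow> (\<forall>j\<in>J. t $ j = 0)"
    proof (intro allI impI ballI)
      fix t :: "real^'n" and j
      assume sum: "(\<Sum>j\<in>J. t $ j *\<^sub>R c j) = 0" and j: "j \<in> J"
      show "t $ j = 0"
      proof (rule ccontr)
        assume nz: "t $ j \<noteq> 0"
        have "t $ j *\<^sub>R c j = - (\<Sum>l\<in>J-{j}. t $ l *\<^sub>R c l)"
          using sum j by (simp add: sum.remove[of J j] eq_neg_iff_add_eq_0)
        have "c j = inverse (t $ j) *\<^sub>R (t $ j *\<^sub>R c j)" using nz by simp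
        also have "\<dots> = (\<Sum>l\<in>J-{j}. (- inverse (t $ j) * t $ l) *\<^sub>R c l)"
          unfolding \<open>t $ j *\<^sub>R c j = _\<close> by (simp add: scaleR_sum_right sum_negf)
        finally have "c j = (\<Sum>l\<in>J-{j}. (\<chi> l. - inverse (t $ j) * t $ l) $ l *\<^sub>R c l)" by simp
        with c j show False by blast
      qed
    qed
  qed
qed

text \<open>Chernoff's bound with exponent \<open>l = 1 / (card I - 1)\<close>; write \<open>\<Pi>\<close> for the projector onto \<open>V\<close>.  Given \<open>y i = a\<close>, the correlation is
  \<open>(norm (\<Pi> a))\<^sup>2\<close> plus a centred Gaussian of variance \<open>(card I - 1) * (norm (\<Pi> a))\<^sup>2\<close>, so the
  conditional moment is \<open>exp (- (l / 2) * (norm (\<Pi> a))\<^sup>2)\<close>, and this choice of \<open>l\<close> minimises it.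
  Integrating over \<open>a\<close> gives the power of \<open>1 / (1 + l) = 1 - 1 / card I\<close>.\<close>

lemma gauss_projected_correlation_tail:
  fixes V :: "'a::euclidean_space set" and I :: "'n set" and s :: "'n \<Rightarrow> real"
  assumes V: "subspace V" and I: "finite I" "i \<in> I" "card I \<ge> 2"
    and s: "\<And>j. j \<in> I \<Longrightarrow> s j * s j = 1"
  defines "E \<equiv> {y \<in> space (PiM I (\<lambda>_. gauss)). (s i *\<^sub>R y i) \<bullet> orth_proj V (\<Sum>j\<in>I. s j *\<^sub>R y j) \<le> 0}"
  shows "E \<in> sets (PiM I (\<lambda>_. gauss :: 'a measure))"
    and "emeasure (PiM I (\<lambda>_. gauss :: 'a measure)) E \<le> ennreal (sqrt (1 - 1 / card I) ^ dim V)"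
proof -
  interpret product_prob_space "\<lambda>_::'n. gauss :: 'a measure" by (rule product_prob_space_gauss)
  have [measurable]: "orth_proj V \<in> borel_measurable borel"
    by (intro borel_measurable_linear linear_orth_proj V)
  define J where "J = I - {i}"
  have J: "I = insert i J" "finite J" "i \<notin> J" "i \<in> I" using I by (auto simp: J_def)
  define k where "k = real (card I)"
  have k: "k \<ge> 2" "real (card J) = k - 1"
    using I by (auto simp: k_def J_def)
  define h where "h y = (s i *\<^sub>R y i) \<bullet> orth_proj V (\<Sum>j\<in>I. s j *\<^sub>R y j)" for y :: "'n \<Rightarrow> 'a"
  have hm[measurable]: "h \<in> borel_measurable (PiM I (\<lambda>_. gauss :: 'a measure))"
    unfolding h_def using J(4) by measurable
  have E: "E = {y \<in> space (PiM I (\<lambda>_. gauss)). h y \<le> 0}" by (simp add: E_def h_def)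
  show Em: "E \<in> sets (PiM I (\<lambda>_. gauss :: 'a measure))" unfolding E by measurable
  define l where "l = 1 / (k - 1)"
  have l: "l > 0" using k by (simp add: l_def)
  have hJ: "h (y(i := a)) = (norm (orth_proj V a))\<^sup>2 + (\<Sum>j\<in>J. (s i * s j) *\<^sub>R orth_proj V a \<bullet> y j)" for y a
  proof -
    have sum: "(\<Sum>j\<in>I. s j *\<^sub>R (y(i := a)) j) = s i *\<^sub>R a + (\<Sum>j\<in>J. s j *\<^sub>R y j)"
      unfolding J(1) using J(2,3) by (subst sum.insert) (auto intro!: sum.cong)
    have "(a - orth_proj V a) \<bullet> orth_proj V a = 0"
      using orth_proj_orthogonal[OF V orth_proj_in[OF V]] by (simp add: orthogonal_def)
    then have Pa: "orth_proj V a \<bullet> a = (norm (orth_proj V a))\<^sup>2"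
      by (simp add: inner_diff_left power2_norm_eq_inner inner_commute[of a])
    have lin: "orth_proj V (s i *\<^sub>R a) = s i *\<^sub>R orth_proj V a"
      by (rule linear_scale[OF linear_orth_proj[OF V]])
    have "h (y(i := a)) = orth_proj V (s i *\<^sub>R a) \<bullet> (s i *\<^sub>R a + (\<Sum>j\<in>J. s j *\<^sub>R y j))"
      unfolding h_def sum by (simp only: fun_upd_same orth_proj_sym[OF V])
    also have "\<dots> = (s i * s i) * (orth_proj V a \<bullet> a) + (\<Sum>j\<in>J. (s i * s j) *\<^sub>R orth_proj V a \<bullet> y j)"
      by (simp only: lin inner_add_right inner_sum_right inner_scaleR_left inner_scaleR_right mult_ac)
    also have "\<dots> = (norm (orth_proj V a))\<^sup>2 + (\<Sum>j\<in>J. (s i * s j) *\<^sub>R orth_proj V a \<bullet> y j)"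
      by (simp only: Pa s[OF J(4)] mult_1_left)
    finally show ?thesis .
  qed
  have inner: "(\<integral>\<^sup>+y. ennreal (exp (- l * h (y(i := a)))) \<partial>PiM J (\<lambda>_. gauss))
      = ennreal (exp (- (l / 2) * (norm (orth_proj V a))\<^sup>2))" for a
  proof -
    let ?n = "(norm (orth_proj V a))\<^sup>2"
    let ?v = "\<lambda>j. (- l * (s i * s j)) *\<^sub>R orth_proj V a"
    have split: "ennreal (exp (- l * h (y(i := a))))
        = ennreal (exp (- l * ?n)) * (\<Prod>j\<in>J. ennreal (exp (?v j \<bullet> y j)))" for y
    proof -
      have "- l * h (y(i := a)) = - l * ?n + (\<Sum>j\<in>J. ?v j \<bullet> y j)"
        unfolding hJ by (simp only: inner_scaleR_left distrib_left sum_distrib_left mult.assoc)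
      then have "exp (- l * h (y(i := a))) = exp (- l * ?n) * (\<Prod>j\<in>J. exp (?v j \<bullet> y j))"
        by (simp only: exp_add exp_sum[OF J(2)])
      then show ?thesis
        by (simp only: ennreal_mult' exp_ge_zero prod_ennreal prod_nonneg)
    qed
    have mgf: "(\<integral>\<^sup>+x. ennreal (exp (?v j \<bullet> x)) \<partial>gauss) = ennreal (exp (l\<^sup>2 * ?n / 2))" if "j \<in> J" for j
    proof -
      have "j \<in> I" using that J(1) by blast
      have "(s i * s j)\<^sup>2 = (s i * s i) * (s j * s j)"
        by (simp only: power2_eq_square mult_ac)
      also have "\<dots> = 1" by (simp only: s[OF \<open>i \<in> I\<close>] s[OF \<open>j \<in> I\<close>] mult_1_left)
      finally have "(s i * s j)\<^sup>2 = 1" .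
      then have "(norm (?v j))\<^sup>2 = l\<^sup>2 * ?n"
        by (simp only: norm_scaleR power_mult_distrib power2_abs power2_minus mult_1_right)
      then show ?thesis by (simp only: nn_integral_gauss_exp_inner)
    qed
    have cJ: "real (card J) * (l\<^sup>2 * ?n / 2) = l * ?n / 2"
      using k by (simp add: l_def power2_eq_square)
    have "(\<integral>\<^sup>+y. ennreal (exp (- l * h (y(i := a)))) \<partial>PiM J (\<lambda>_. gauss))
        = ennreal (exp (- l * ?n)) * (\<integral>\<^sup>+y. (\<Prod>j\<in>J. ennreal (exp (?v j \<bullet> y j))) \<partial>PiM J (\<lambda>_. gauss))"
      unfolding split by (rule nn_integral_cmult) measurable
    also have "\<dots> = ennreal (exp (- l * ?n)) * (\<Prod>j\<in>J. \<integral>\<^sup>+x. ennreal (exp (?v j \<bullet> x)) \<partial>gauss)"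
      by (subst product_nn_integral_prod[OF J(2), where f = "\<lambda>j x. ennreal (exp (?v j \<bullet> x))"]) auto
    also have "\<dots> = ennreal (exp (- l * ?n)) * ennreal (exp (l\<^sup>2 * ?n / 2)) ^ card J"
      using mgf by simp
    also have "\<dots> = ennreal (exp (- l * ?n) * exp (real (card J) * (l\<^sup>2 * ?n / 2)))"
      by (simp only: exp_of_nat_mult ennreal_power exp_ge_zero ennreal_mult')
    also have "\<dots> = ennreal (exp (- (l / 2) * ?n))"
      unfolding cJ by (simp add: mult_exp_exp)
    finally show ?thesis .
  qed
  have "emeasure (PiM I (\<lambda>_. gauss)) E = (\<integral>\<^sup>+y. indicator E y \<partial>PiM I (\<lambda>_. gauss))"
    using Em by simp
  also have "\<dots> \<le> (\<integral>\<^sup>+y. ennreal (exp (- l * h y)) \<partial>PiM I (\<lambda>_. gauss))"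
  proof (rule nn_integral_mono)
    fix y :: "'n \<Rightarrow> 'a"
    show "indicator E y \<le> ennreal (exp (- l * h y))"
      using l by (auto simp: E indicator_def mult_nonneg_nonpos)
  qed
  also have "\<dots> = (\<integral>\<^sup>+a. \<integral>\<^sup>+y. ennreal (exp (- l * h (y(i := a)))) \<partial>PiM J (\<lambda>_. gauss) \<partial>gauss)"
  proof -
    have [measurable]: "h \<in> borel_measurable (PiM (insert i J) (\<lambda>_. gauss))"
      unfolding J(1)[symmetric] by (rule hm)
    show ?thesis
      unfolding J(1) by (rule product_nn_integral_insert_rev[OF J(2,3)]) measurable
  qed
  also have "\<dots> = (\<integral>\<^sup>+a. ennreal (exp (- (l / 2) * (norm (orth_proj V a))\<^sup>2)) \<partial>gauss)"
    by (simp only: inner)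
  also have "\<dots> = ennreal ((1 / sqrt (1 + 2 * (l / 2))) ^ dim V)"
    by (rule nn_integral_gauss_exp_proj[OF V]) (use l in simp)
  also have "(1 / sqrt (1 + 2 * (l / 2))) ^ dim V = sqrt (1 - 1 / card I) ^ dim V"
  proof -
    have "1 - 1 / k = 1 / (1 + 2 * (l / 2))" using k by (simp add: l_def field_simps)
    then show ?thesis by (simp add: real_sqrt_divide k_def)
  qed
  finally show "emeasure (PiM I (\<lambda>_. gauss)) E \<le> ennreal (sqrt (1 - 1 / card I) ^ dim V)" .
qed

section \<open>The probability bound\<close>

definition matrix_of_columns :: "('n \<Rightarrow> real^'q) \<Rightarrow> real^'n^'q" where
  "matrix_of_columns c = (\<chi> q n. c n $ q)"

lemma column_matrix_of_columns [simp]: "column n (matrix_of_columns c) = c n"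
  by (simp add: matrix_of_columns_def column_def vec_eq_iff)

lemma matrix_of_columns_column [simp]: "matrix_of_columns (\<lambda>n. column n A) = A"
  by (simp add: matrix_of_columns_def column_def vec_eq_iff)

lemma measurable_matrix_of_columns:
  "matrix_of_columns \<in> borel_measurable (PiM UNIV (\<lambda>_::'n::finite. gauss :: (real^'q) measure))"
  unfolding matrix_of_columns_def
proof (intro borel_measurable_vecI)
  fix q :: 'q and n :: 'n
  have "(\<lambda>c. c n \<bullet> axis q 1) \<in> borel_measurable (PiM UNIV (\<lambda>_::'n. gauss :: (real^'q) measure))"
    by measurable
  then show "(\<lambda>c. (\<chi> q n. c n $ q) $ q $ n) \<in> borel_measurable (PiM UNIV (\<lambda>_::'n. gauss :: (real^'q) measure))"
    by (simp add: inner_axis)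
qed

text \<open>By Fubini's theorem the columns outside the support can be held fixed.  For almost all of them
  the sufficient condition applies, and the inner failure event is covered by one event
  \<open>E i\<close> for each \<open>i\<close> in the support.\<close>

lemma gauss_columns_failure_bound:
  fixes x :: "real^'n"
  assumes x: "x \<noteq> 0"
  defines "k \<equiv> card (sat_supp x)"
  assumes k: "k \<ge> 2" and dims: "CARD('n) - k + m \<le> CARD('q)"
  shows "emeasure (PiM UNIV (\<lambda>_::'n. gauss :: (real^'q) measure))
      {c \<in> space (PiM UNIV (\<lambda>_. gauss)). \<not> (IC_defined (matrix_of_columns c) x \<and> IC (matrix_of_columns c) x < 1)}
    \<le> ennreal (real k * sqrt (1 - 1 / real k) ^ m)"
    (is "emeasure ?\<mu> ?N \<le> _")
proof -
  interpret product_prob_space "\<lambda>_::'n. gauss :: (real^'q) measure" by (rule product_prob_space_gauss)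
  let ?I = "sat_supp x" and ?s = "sat_sign x"
  have cI: "card (- ?I) = CARD('n) - k" by (simp add: k_def Compl_eq_Diff_UNIV card_Diff_subset)
  have Q: "card (- ?I) + m \<le> CARD('q)" using dims cI by simp
  have "?N = matrix_of_columns -` (- {\<Phi>. IC_defined \<Phi> x \<and> IC \<Phi> x < 1}) \<inter> space ?\<mu>" by auto
  also have "\<dots> \<in> sets ?\<mu>"
    by (intro measurable_sets[OF measurable_matrix_of_columns] borel_comp sets_borel_IC_less_one x)
  finally have N: "?N \<in> sets ?\<mu>" .
  have U: "- ?I \<union> ?I = UNIV" by auto
  define \<delta> where "\<delta> = sqrt (1 - 1 / real k)"
  have \<delta>: "0 \<le> \<delta>" "\<delta> \<le> 1" using k by (auto simp: \<delta>_def)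
  have "emeasure ?\<mu> ?N = (\<integral>\<^sup>+c. indicator ?N c \<partial>PiM (- ?I \<union> ?I) (\<lambda>_. gauss :: (real^'q) measure))"
    unfolding U using N by simp
  also have "\<dots> = (\<integral>\<^sup>+c. \<integral>\<^sup>+y. indicator ?N (merge (- ?I) ?I (c, y))
      \<partial>PiM ?I (\<lambda>_. gauss :: (real^'q) measure) \<partial>PiM (- ?I) (\<lambda>_. gauss :: (real^'q) measure))"
    by (rule product_nn_integral_fold) (use N U in auto)
  also have "\<dots> \<le> (\<integral>\<^sup>+c. ennreal (real k * \<delta> ^ m) \<partial>PiM (- ?I) (\<lambda>_. gauss :: (real^'q) measure))"
  proof (rule nn_integral_mono_AE)
    have "AE c in PiM (- ?I) (\<lambda>_. gauss :: (real^'q) measure).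
        \<forall>t::real^'n. (\<Sum>j\<in>- ?I. t $ j *\<^sub>R c j) = 0 \<longrightarrow> (\<forall>j\<in>- ?I. t $ j = 0)"
      by (rule AE_gauss_columns_independent) (use Q in simp)
    then show "AE c in PiM (- ?I) (\<lambda>_. gauss :: (real^'q) measure).
        (\<integral>\<^sup>+y. indicator ?N (merge (- ?I) ?I (c, y)) \<partial>PiM ?I (\<lambda>_. gauss :: (real^'q) measure))
          \<le> ennreal (real k * \<delta> ^ m)"
    proof eventually_elim
      fix c :: "'n \<Rightarrow> real^'q"
      assume indep: "\<forall>t::real^'n. (\<Sum>j\<in>- ?I. t $ j *\<^sub>R c j) = 0 \<longrightarrow> (\<forall>j\<in>- ?I. t $ j = 0)"
      define V where "V = off_support_complement ?I c"
      have V: "subspace V" unfolding V_def by (rule subspace_off_support_complement)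
      have dV: "m \<le> dim V" using dim_off_support_complement[of ?I c] Q by (simp add: V_def)
      define E where "E i = {y \<in> space (PiM ?I (\<lambda>_. gauss :: (real^'q) measure)).
          (?s $ i *\<^sub>R y i) \<bullet> orth_proj V (\<Sum>j\<in>?I. ?s $ j *\<^sub>R y j) \<le> 0}" for i
      have E: "E i \<in> sets (PiM ?I (\<lambda>_. gauss :: (real^'q) measure))"
        "emeasure (PiM ?I (\<lambda>_. gauss :: (real^'q) measure)) (E i) \<le> ennreal (\<delta> ^ m)" if "i \<in> ?I" for i
      proof -
        have I: "finite ?I" "card ?I \<ge> 2" using k by (auto simp: k_def)
        note tail = gauss_projected_correlation_tail[OF V I(1) that I(2), of "\<lambda>j. ?s $ j", OF sat_sign_square[OF x]]
        show "E i \<in> sets (PiM ?I (\<lambda>_. gauss :: (real^'q) measure))"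
          unfolding E_def by (rule tail(1))
        have "emeasure (PiM ?I (\<lambda>_. gauss :: (real^'q) measure)) (E i) \<le> ennreal (\<delta> ^ dim V)"
          unfolding E_def \<delta>_def k_def by (rule tail(2))
        also have "\<dots> \<le> ennreal (\<delta> ^ m)"
          by (intro ennreal_leI power_decreasing dV \<delta>)
        finally show "emeasure (PiM ?I (\<lambda>_. gauss :: (real^'q) measure)) (E i) \<le> ennreal (\<delta> ^ m)" .
      qed
      have sub: "y \<in> (\<Union>i\<in>?I. E i)"
        if y: "y \<in> space (PiM ?I (\<lambda>_. gauss :: (real^'q) measure))" and bad: "merge (- ?I) ?I (c, y) \<in> ?N" for y
      proof (rule ccontr)
        assume no: "y \<notin> (\<Union>i\<in>?I. E i)"
        define \<Phi> where "\<Phi> = matrix_of_columns (merge (- ?I) ?I (c, y))"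
        have colI: "column i \<Phi> = y i" if "i \<in> ?I" for i using that by (simp add: \<Phi>_def merge_def)
        have colJ: "column j \<Phi> = c j" if "j \<in> - ?I" for j using that by (simp add: \<Phi>_def merge_def)
        have V': "off_support_complement ?I (\<lambda>j. column j \<Phi>) = V"
          by (simp add: V_def off_support_complement_def colJ)
        have s: "\<Phi> *v ?s = (\<Sum>j\<in>?I. ?s $ j *\<^sub>R y j)"
          unfolding matrix_mult_sat_sign by (simp add: colI)
        have "IC_defined \<Phi> x \<and> IC \<Phi> x < 1"
        proof (rule IC_less_one_if_projected_correlations_pos[OF x])
          fix t :: "real^'n" assume t: "\<And>i. i \<in> ?I \<Longrightarrow> t $ i = 0" "\<Phi> *v t = 0"
          have "\<Phi> *v t = (\<Sum>j\<in>-?I. t $ j *\<^sub>R column j \<Phi>)"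
            by (rule matrix_mult_off_supp) (rule t(1))
          then have "(\<Sum>j\<in>-?I. t $ j *\<^sub>R c j) = 0" using t(2) by (simp add: colJ)
          then have "\<forall>j\<in>-?I. t $ j = 0" using indep by blast
          then show "t = 0" using t(1) by (auto simp: vec_eq_iff)
        next
          fix i assume i: "i \<in> ?I"
          then have "\<not> (?s $ i *\<^sub>R y i) \<bullet> orth_proj V (\<Sum>j\<in>?I. ?s $ j *\<^sub>R y j) \<le> 0"
            using no y unfolding E_def by blast
          then show "(?s $ i *\<^sub>R column i \<Phi>) \<bullet> orth_proj (off_support_complement ?I (\<lambda>j. column j \<Phi>)) (\<Phi> *v ?s) > 0"
            unfolding V' s colI[OF i] by simp
        qed
        with bad show False by (simp add: \<Phi>_def)
      qed
      have "(\<integral>\<^sup>+y. indicator ?N (merge (- ?I) ?I (c, y)) \<partial>PiM ?I (\<lambda>_. gauss :: (real^'q) measure))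
          \<le> (\<integral>\<^sup>+y. indicator (\<Union>i\<in>?I. E i) y \<partial>PiM ?I (\<lambda>_. gauss :: (real^'q) measure))"
        by (intro nn_integral_mono) (use sub in \<open>auto simp: indicator_def\<close>)
      also have "\<dots> = emeasure (PiM ?I (\<lambda>_. gauss :: (real^'q) measure)) (\<Union>i\<in>?I. E i)"
        by (intro nn_integral_indicator sets.finite_UN E) auto
      also have "\<dots> \<le> (\<Sum>i\<in>?I. emeasure (PiM ?I (\<lambda>_. gauss :: (real^'q) measure)) (E i))"
        by (intro emeasure_subadditive_finite) (auto intro: E)
      also have "\<dots> \<le> (\<Sum>i\<in>?I. ennreal (\<delta> ^ m))"
        by (intro sum_mono E)
      also have "\<dots> = ennreal (real k * \<delta> ^ m)"
        using \<delta> by (simp add: k_def ennreal_mult' ennreal_of_nat_eq_real_of_nat)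
      finally show "(\<integral>\<^sup>+y. indicator ?N (merge (- ?I) ?I (c, y)) \<partial>PiM ?I (\<lambda>_. gauss :: (real^'q) measure))
          \<le> ennreal (real k * \<delta> ^ m)" .
    qed
  qed
  also have "\<dots> = ennreal (real k * \<delta> ^ m)"
  proof -
    have "prob_space (PiM (- ?I) (\<lambda>_. gauss :: (real^'q) measure))"
      by (intro prob_space_PiM prob_space_gauss)
    then show ?thesis by (simp add: prob_space.emeasure_space_1)
  qed
  finally show ?thesis by (simp add: \<delta>_def)
qed

lemma decay_exponent_le:
  assumes "\<beta> > 1" "n > 0"
  shows "decay_exponent \<beta> n \<le> \<beta> - 1"
proof -
  define b where "b = \<beta> / (2 * real n)"
  have b: "b > 0" using assms by (simp add: b_def)
  define p q where "p = sqrt (b + \<beta> - 1)" and "q = sqrt b"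
  have pq: "0 \<le> q" "q \<le> p" "p\<^sup>2 = b + \<beta> - 1" "q\<^sup>2 = b"
    using b assms by (auto simp: p_def q_def)
  have "(p - q)\<^sup>2 = (p - q) * (p - q)" by (simp add: power2_eq_square)
  also have "\<dots> \<le> (p - q) * (p + q)" using pq by (intro mult_left_mono) auto
  also have "\<dots> = p\<^sup>2 - q\<^sup>2" by (simp add: power2_eq_square algebra_simps)
  finally show ?thesis
    using pq by (simp add: decay_exponent_def p_def q_def b_def)
qed

text \<open>The dimension condition bounds \<open>exp (- m / (2 k))\<close> by \<open>(k / 2) powr (- \<beta>)\<close>, and the union
  bound factor \<open>k\<close> is \<open>2 (k / 2)\<close>.\<close>

lemma failure_bound_le:
  fixes k m :: nat
  assumes k: "k \<ge> 3" and b: "\<beta> > 1"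
    and m: "real m \<ge> 2 * \<beta> * real k * ln (real k / 2)"
  shows "real k * sqrt (1 - 1 / real k) ^ m \<le> 2 * (real k / 2) powr (- decay_exponent \<beta> k)"
proof -
  let ?L = "ln (real k / 2)"
  have L: "?L > 0" using k by simp
  have "sqrt (1 - 1 / real k) \<le> exp (- 1 / (2 * real k))"
  proof -
    have "1 - 1 / real k \<le> exp (- 1 / real k)"
      using exp_ge_add_one_self[of "- 1 / real k"] by simp
    also have "\<dots> = (exp (- 1 / (2 * real k)))\<^sup>2"
      by (simp add: power2_eq_square mult_exp_exp)
    finally show ?thesis by (intro real_le_lsqrt) auto
  qed
  then have "sqrt (1 - 1 / real k) ^ m \<le> exp (- 1 / (2 * real k)) ^ m"
    using k by (intro power_mono) auto
  also have "\<dots> = exp (- (real m / (2 * real k)))"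
    by (simp add: exp_of_nat_mult[symmetric])
  also have "\<dots> \<le> exp (- (\<beta> * ?L))"
  proof -
    have "\<beta> * ?L \<le> real m / (2 * real k)" using m k by (simp add: field_simps)
    then show ?thesis by simp
  qed
  finally have "real k * sqrt (1 - 1 / real k) ^ m \<le> real k * exp (- (\<beta> * ?L))"
    by (intro mult_left_mono) auto
  also have "\<dots> = 2 * (real k / 2) powr (1 - \<beta>)"
  proof -
    have "(real k / 2) powr (1 - \<beta>) = (real k / 2) * exp (- (\<beta> * ?L))"
      using k by (simp add: powr_def left_diff_distrib exp_diff exp_minus field_simps)
    then show ?thesis by simp
  qed
  also have "\<dots> \<le> 2 * (real k / 2) powr (- decay_exponent \<beta> k)"
    using decay_exponent_le[OF b, of k] k by (intro mult_left_mono powr_mono) auto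
  finally show ?thesis .
qed

theorem theorem7:
  fixes x :: "real^'n" and \<beta> :: real
    and M :: "'w measure" and \<Phi> :: "'w \<Rightarrow> real^'n^'q"
  assumes "x \<noteq> 0"
    and "\<beta> > 1"
    and "std_gaussian_ensemble M \<Phi>"
    and "real CARD('q) \<ge> real CARD('n) - real (card (sat_supp x))
           + 2 * \<beta> * real (card (sat_supp x)) * ln (real (card (sat_supp x)) / 2)"
  shows "measure M {\<omega> \<in> space M. IC_defined (\<Phi> \<omega>) x \<and> IC (\<Phi> \<omega>) x < 1}
           \<ge> 1 - 2 * (real (card (sat_supp x)) / 2) powr (- decay_exponent \<beta> (card (sat_supp x)))"
proof -
  define k where "k = card (sat_supp x)"
  have k0: "k > 0" using card_sat_supp_pos[of x] by (simp add: k_def)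
  define A where "A = {\<omega> \<in> space M. IC_defined (\<Phi> \<omega>) x \<and> IC (\<Phi> \<omega>) x < 1}"
  have "measure M A \<ge> 1 - 2 * (real k / 2) powr (- decay_exponent \<beta> k)"
  proof (cases "k \<ge> 3")
    case False
    \<comment> \<open>For \<open>k \<le> 2\<close> the claimed lower bound is at most \<open>-1\<close>.\<close>
    have "- decay_exponent \<beta> k * ln (real k / 2) \<ge> 0"
      using False k0 by (intro mult_nonpos_nonpos) (auto simp: decay_exponent_def)
    then have "1 \<le> (real k / 2) powr (- decay_exponent \<beta> k)"
      using k0 by (simp add: powr_def)
    then show ?thesis using measure_nonneg[of M A] by linarith
  next
    case True
    interpret prob_space M using assms(3) by (simp add: std_gaussian_ensemble_def)
    let ?\<mu> = "PiM UNIV (\<lambda>_::'n. gauss :: (real^'q) measure)"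
    have kN: "k \<le> CARD('n)" unfolding k_def by (intro card_mono) auto
    have "0 \<le> 2 * \<beta> * real k * ln (real k / 2)" using True assms(2) by simp
    then have "CARD('n) - k \<le> CARD('q)" using assms(4) kN unfolding k_def[symmetric] by linarith
    then obtain m where m: "CARD('q) = CARD('n) - k + m" using le_Suc_ex by blast
    have mr: "real m \<ge> 2 * \<beta> * real k * ln (real k / 2)"
      using assms(4) m kN unfolding k_def[symmetric] by (simp add: of_nat_diff)
    define C where "C \<omega> = (\<lambda>n. column n (\<Phi> \<omega>))" for \<omega>
    have "distributed M lborel (\<lambda>\<omega>. \<Phi> \<omega> $ q $ n) std_normal_density" for q n
      using assms(3) by (simp add: std_gaussian_ensemble_def)
    from distributed_measurable[OF this]
    have rv: "(\<lambda>\<omega>. \<Phi> \<omega> $ q $ n) \<in> borel_measurable M" for q n by simp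
    have C: "C \<in> M \<rightarrow>\<^sub>M PiM UNIV (\<lambda>_. borel)"
      unfolding C_def column_def
      by (rule measurable_PiM_single') (auto intro!: borel_measurable_vecI rv)
    have law: "distr M (PiM UNIV (\<lambda>_. borel)) C = ?\<mu>"
      using distr_columns_gaussian_ensemble[OF assms(3)] by (simp add: C_def[abs_def])
    define N where "N = {c \<in> space ?\<mu>. \<not> (IC_defined (matrix_of_columns c) x \<and> IC (matrix_of_columns c) x < 1)}"
    have "N = matrix_of_columns -` (- {\<Phi>. IC_defined \<Phi> x \<and> IC \<Phi> x < 1}) \<inter> space ?\<mu>"
      by (auto simp: N_def)
    also have "\<dots> \<in> sets ?\<mu>"
      by (intro measurable_sets[OF measurable_matrix_of_columns] borel_comp sets_borel_IC_less_one assms(1))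
    finally have N: "N \<in> sets ?\<mu>" .
    then have N': "N \<in> sets (PiM UNIV (\<lambda>_::'n. borel :: (real^'q) measure))"
      using law by (metis sets_distr)
    have CN: "C -` N \<inter> space M = space M - A"
      by (auto simp: N_def A_def C_def space_PiM)
    have "space M - A \<in> sets M" using measurable_sets[OF C N'] CN by simp
    then have "space M - (space M - A) \<in> sets M" by (rule sets.compl_sets)
    moreover have "space M - (space M - A) = A" by (auto simp: A_def)
    ultimately have A: "A \<in> events" by simp
    have "emeasure M (space M - A) = emeasure ?\<mu> N"
      unfolding law[symmetric] using emeasure_distr[OF C N'] CN by simp
    also have "\<dots> \<le> ennreal (real k * sqrt (1 - 1 / real k) ^ m)"
      using gauss_columns_failure_bound[OF assms(1), where 'q = 'q, of m] True m by (simp add: N_def k_def)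
    finally have "prob (space M - A) \<le> real k * sqrt (1 - 1 / real k) ^ m"
      unfolding emeasure_eq_measure using True by (subst (asm) ennreal_le_iff) auto
    also have "\<dots> \<le> 2 * (real k / 2) powr (- decay_exponent \<beta> k)"
      by (rule failure_bound_le[OF True assms(2) mr])
    finally show ?thesis using prob_compl[OF A] by simp
  qed
  then show ?thesis by (simp add: A_def k_def)
qed

end
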